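(* Let $k$ and $m$ be positive integers, let $G = (V,E)$ be a graph, let $T$ be a tree of order $m$, let $X \subsetneq V$, and let $q \ge 0$ be an integer. Suppose that $k \ge q$, that $G[X]$ contains a clique of size $q$, and that $$d(v) \ge k + m - 1 + |X| - q \quad \text{for all } v \in V - X.$$ (i) If $G$ is $k$-connected, then there exists a subtree $T'$ of $G - X$, isomorphic to $T$, such that $G - E(T')$ is $k$-connected. (ii) If $G$ is $k$-edge-connected, then there exists a subtree $T'$ of $G - X$, isomorphic to $T$, such that $G - E(T')$ is $k$-edge-connected.
   Context: All graphs are finite, undirected and simple. The order of a graph is its number of vertices. $d(v)$ is the degree of $v$ in $G$. $G[X]$ is the subgraph of $G$ induced by $X$, and $G - X$ is the subgraph induced by $V - X$. A clique of size $q$ is a complete subgraph on $q$ vertices (for $q=0$ the condition holds trivially; $X=\emptyset$ is allowed). A graph is $k$-connected if it has at least $k+1$ vertices and remains connected after deleting any set of fewer than $k$ vertices; it is $k$-edge-connected if it remains connected after deleting any set of fewer than $k$ edges. A subtree is a (not necessarily induced) subgraph that is a tree. $G - E(T')$ denotes the graph with vertex set $V$ obtained by deleting the edges of $T'$ (no vertices are deleted). *)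

theory Defs
  imports Main "HOL-Library.Ramsey"
begin

record 'a ugraph =
  verts :: "'a set"
  edges :: "'a set set"

text \<open>Finite, undirected, simple: edges are two-element sets of vertices, so there are no
  loops and no parallel edges.\<close>

definition simple_graph :: "'a ugraph \<Rightarrow> bool" where
  "simple_graph G \<longleftrightarrow> finite (verts G) \<and> edges G \<subseteq> nsets (verts G) 2"

definition degree :: "'a ugraph \<Rightarrow> 'a \<Rightarrow> nat" where
  "degree G v = card {e \<in> edges G. v \<in> e}"

definition subgraph :: "'a ugraph \<Rightarrow> 'a ugraph \<Rightarrow> bool" where
  "subgraph H G \<longleftrightarrow> simple_graph H \<and> verts H \<subseteq> verts G \<and> edges H \<subseteq> edges G"

text \<open>Meant for \<open>X \<subseteq> verts G\<close>.\<close>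

definition induced :: "'a ugraph \<Rightarrow> 'a set \<Rightarrow> 'a ugraph" where
  "induced G X = \<lparr>verts = X, edges = {e \<in> edges G. e \<subseteq> X}\<rparr>"

definition del_verts :: "'a ugraph \<Rightarrow> 'a set \<Rightarrow> 'a ugraph" where
  "del_verts G X = induced G (verts G - X)"

definition del_edges :: "'a ugraph \<Rightarrow> 'a set set \<Rightarrow> 'a ugraph" where
  "del_edges G F = \<lparr>verts = verts G, edges = edges G - F\<rparr>"

text \<open>In a simple graph, the reflexive transitive closure of adjacency relates exactly the
  pairs of vertices joined by a walk (and each vertex to itself).
  The graph without vertices does not count as connected.\<close>

definition connected_graph :: "'a ugraph \<Rightarrow> bool" where
  "connected_graph G \<longleftrightarrow> verts G \<noteq> {} \<and>
     (\<forall>u\<in>verts G. \<forall>v\<in>verts G. (u, v) \<in> {(x, y). {x, y} \<in> edges G}\<^sup>*)"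

definition k_connected :: "nat \<Rightarrow> 'a ugraph \<Rightarrow> bool" where
  "k_connected k G \<longleftrightarrow> card (verts G) \<ge> k + 1 \<and>
     (\<forall>S. S \<subseteq> verts G \<and> card S < k \<longrightarrow> connected_graph (del_verts G S))"

definition k_edge_connected :: "nat \<Rightarrow> 'a ugraph \<Rightarrow> bool" where
  "k_edge_connected k G \<longleftrightarrow>
     (\<forall>F. F \<subseteq> edges G \<and> card F < k \<longrightarrow> connected_graph (del_edges G F))"

text \<open>A cycle is given by the list of its vertices, each occurring once; the last
  is adjacent to the first.\<close>

definition is_cycle :: "'a ugraph \<Rightarrow> 'a list \<Rightarrow> bool" where
  "is_cycle G c \<longleftrightarrow> length c \<ge> 3 \<and> distinct c \<and> set c \<subseteq> verts G \<and>
     (\<forall>i < length c. {c ! i, c ! (Suc i mod length c)} \<in> edges G)"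

definition tree :: "'a ugraph \<Rightarrow> bool" where
  "tree T \<longleftrightarrow> simple_graph T \<and> connected_graph T \<and> (\<nexists>c. is_cycle T c)"

definition subtree :: "'a ugraph \<Rightarrow> 'a ugraph \<Rightarrow> bool" where
  "subtree T G \<longleftrightarrow> subgraph T G \<and> tree T"

definition isomorphic :: "'a ugraph \<Rightarrow> 'b ugraph \<Rightarrow> bool" where
  "isomorphic G H \<longleftrightarrow> (\<exists>f. bij_betw f (verts G) (verts H) \<and>
     (\<forall>u\<in>verts G. \<forall>v\<in>verts G. {u, v} \<in> edges G \<longleftrightarrow> {f u, f v} \<in> edges H))"

definition has_clique :: "'a ugraph \<Rightarrow> nat \<Rightarrow> bool" where
  "has_clique G q \<longleftrightarrow> (\<exists>Q \<subseteq> verts G. finite Q \<and> card Q = q \<and> clique Q (edges G))"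

end

theory Submission
  imports Defs
begin

text \<open>
  The tree is built leaf by leaf, and the issue is to choose the edges so that connectivity
  survives.  Removing one edge lowers connectivity by at most one, so if the graph were
  more highly connected than required, one could place the tree minus a leaf while keeping
  the surplus and then add any free edge.  When there is no surplus, some set is tight, and
  the whole construction is moved inside a tight set, where it does not disturb the rest.

  \<^bold>\<open>Edge connectivity.\<close>  Fix a root \<open>r\<close>, taken inside the clique when the clique is not
  empty, and consider sets \<open>D\<close> avoiding \<open>r\<close>.  A tree with vertices in \<open>U = D - X\<close> only changes
  the cuts of sets that split \<open>U\<close>, so it is enough that these keep \<open>K\<close> edges.  If all of them have
  at least \<open>K + 1\<close>, the smaller tree is placed with \<open>K + 1\<close> and any free edge completes it.
  Otherwise pass to a tight set \<open>Y\<close>; submodularity and posimodularity carry the conclusion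
  back from \<open>Y\<close> to \<open>D\<close> (\<open>cut_lift\<close>).  A vertex of \<open>Y - X\<close> still has enough neighbours in
  \<open>Y - X\<close>, because only few edges leave \<open>Y\<close>; its neighbours in \<open>X\<close> are lost, but a clique vertex
  in \<open>Y\<close> also sends an edge to \<open>r\<close> and hence out of \<open>Y\<close>, which makes up for it
  (\<open>tree_keeping_inner_cuts\<close>, \<open>tree_keeping_cuts\<close>).

  \<^bold>\<open>Vertex connectivity.\<close>  Separations are measured by their order plus a surcharge \<open>j\<close> if both
  sides meet \<open>X\<close>; the quantity that is kept is a lower bound \<open>k + j\<close> on this cost.  Removing an edge
  \<open>xy\<close> breaks the bound only if there is a cheap separation with \<open>x\<close> and \<open>y\<close> on
  different sides, and for different neighbours \<open>y\<close> of one vertex \<open>x\<close> of large degree the sides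
  containing the \<open>y\<close> are disjoint (\<open>bad_sides_disjoint\<close>).  All arguments count these sides.

  If the bound also holds with \<open>j + 1\<close> in place of \<open>j\<close>, place the smaller tree keeping that
  bound, and let \<open>x\<close> be the place of the vertex at which the last leaf hangs.  Every
  bad side contains a vertex of \<open>X\<close> that is not a neighbour of \<open>x\<close>, and the degree of \<open>x\<close>
  leaves more candidates than such vertices (\<open>tree_keeping_sep_bound\<close>).  If the bound fails with
  \<open>j + 1\<close>, there is a separation of order exactly \<open>k + j\<close> with a side \<open>D\<close> disjoint from \<open>X\<close>,
  and the tree is placed inside \<open>D\<close> (\<open>tree_in_fragment\<close>).  There a second condition is kept,
  namely that every nonempty subset of \<open>D\<close> has at least \<open>K = |N(D)|\<close> neighbours;
  while it survives, every bad side contains two vertices of \<open>N(D)\<close> (\<open>bad_sep_meets_attachment\<close>).  If a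
  proper subset of \<open>D\<close> has only \<open>K\<close> neighbours, move into it.  Otherwise a star can be placed at any
  centre (\<open>star_case\<close>).  For other trees one vertex \<open>w\<close> is taken out of \<open>D\<close>, which raises \<open>K\<close>
  by one, and the smaller tree is placed in \<open>D - {w}\<close>.  The last edge can then be chosen, unless
  nearly all edges at \<open>x\<close> have been used (\<open>free_edge_or_small_degree\<close>); but that happens only
  for stars.
\<close>

section \<open>Neighbourhoods and vertex separations\<close>

definition nbrs :: "'a set set \<Rightarrow> 'a \<Rightarrow> 'a set" where
  "nbrs E v = {u. {v, u} \<in> E}"

definition nbhd :: "'a set set \<Rightarrow> 'a set \<Rightarrow> 'a set" where
  "nbhd E Y = {v. v \<notin> Y \<and> (\<exists>u\<in>Y. {u, v} \<in> E)}"

text \<open>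
  The set form of submodularity: it is applied to neighbourhoods, separators and cuts, where
  \<open>N1\<close>, \<open>N2\<close> belong to two crossing sets and \<open>P\<close>, \<open>Q\<close> to two opposite corners.
\<close>

lemma card_exchange:
  assumes "finite N1" "finite N2" "P \<union> Q \<subseteq> N1 \<union> N2" "P \<inter> Q \<subseteq> N1 \<inter> N2"
  shows "card P + card Q \<le> card N1 + card N2"
proof -
  have fin: "finite P" "finite Q"
    using assms(1-3) by (meson finite_Un finite_subset)+
  have "card P + card Q = card (P \<union> Q) + card (P \<inter> Q)"
    by (rule card_Un_Int[OF fin])
  also have "\<dots> \<le> card (N1 \<union> N2) + card (N1 \<inter> N2)"
    by (intro add_mono card_mono) (use assms in auto)
  also have "\<dots> = card N1 + card N2"
    using card_Un_Int[OF assms(1,2)] by simp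
  finally show ?thesis .
qed

lemma card_exchange_strict:
  assumes "finite N1" "finite N2" "P \<union> Q \<subseteq> N1 \<union> N2" "P \<inter> Q \<subseteq> N1 \<inter> N2"
    and "x \<in> N1 \<inter> N2" "x \<notin> P \<inter> Q"
  shows "card P + card Q < card N1 + card N2"
proof -
  have fin: "finite P" "finite Q"
    using assms(1-3) by (meson finite_Un finite_subset)+
  have "card P + card Q = card (P \<union> Q) + card (P \<inter> Q)"
    by (rule card_Un_Int[OF fin])
  also have "\<dots> < card (N1 \<union> N2) + card (N1 \<inter> N2)"
    by (intro add_le_less_mono card_mono psubset_card_mono) (use assms in auto)
  also have "\<dots> = card N1 + card N2"
    using card_Un_Int[OF assms(1,2)] by simp
  finally show ?thesis .
qed

lemma disjoint_family_count:
  assumes "finite T" "finite M" "\<And>y. y \<in> T \<Longrightarrow> A y \<subseteq> M \<and> c \<le> card (A y)"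
    "\<And>y y'. y \<in> T \<Longrightarrow> y' \<in> T \<Longrightarrow> y \<noteq> y' \<Longrightarrow> A y \<inter> A y' = {}"
  shows "c * card T \<le> card M"
proof -
  have "c * card T = (\<Sum>y\<in>T. c)" by simp
  also have "\<dots> \<le> (\<Sum>y\<in>T. card (A y))" by (rule sum_mono) (use assms in auto)
  also have "\<dots> = card (\<Union>y\<in>T. A y)"
    by (rule card_UN_disjoint[symmetric]) (use assms finite_subset in blast)+
  also have "\<dots> \<le> card M" by (rule card_mono) (use assms in auto)
  finally show ?thesis .
qed

text \<open>
  The edge set is not fixed by the locale, since edges are removed one after another from a
  graph with the same vertices.
\<close>

locale vertex_sets =
  fixes V X :: "'a set"
  assumes fin_V: "finite V" and X_sub: "X \<subseteq> V"
begin

definition edge_set :: "'a set set \<Rightarrow> bool" where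
  "edge_set E \<longleftrightarrow> E \<subseteq> nsets V 2"

lemma edge_set_mono: "edge_set E \<Longrightarrow> E' \<subseteq> E \<Longrightarrow> edge_set E'"
  by (auto simp: edge_set_def)

lemma edge_setD: "edge_set E \<Longrightarrow> {u, v} \<in> E \<Longrightarrow> u \<in> V \<and> v \<in> V \<and> u \<noteq> v"
  by (auto simp: edge_set_def nsets_def card_insert_if split: if_splits)

lemma edge_setE:
  assumes "edge_set E" "e \<in> E" obtains u v where "e = {u,v}" "u \<noteq> v" "u \<in> V" "v \<in> V"
  using assms unfolding edge_set_def nsets_def by (auto simp: card_2_iff)

lemma nbhd_subset: "edge_set E \<Longrightarrow> nbhd E Y \<subseteq> V"
  by (auto simp: nbhd_def dest: edge_setD)

lemma nbrs_subset: "edge_set E \<Longrightarrow> nbrs E v \<subseteq> V - {v}"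
  by (auto simp: nbrs_def dest: edge_setD)

lemma fin_nbhd: "edge_set E \<Longrightarrow> finite (nbhd E Y)"
  using nbhd_subset fin_V finite_subset by blast

lemma fin_nbrs: "edge_set E \<Longrightarrow> finite (nbrs E v)"
  using nbrs_subset fin_V finite_subset by (metis finite_Diff)

lemma nbhd_singleton: "edge_set E \<Longrightarrow> nbhd E {v} = nbrs E v"
  by (auto simp: nbhd_def nbrs_def dest: edge_setD)

lemma nbhd_submodular:
  assumes "edge_set E"
  shows "card (nbhd E (Y \<inter> Z)) + card (nbhd E (Y \<union> Z)) \<le> card (nbhd E Y) + card (nbhd E Z)"
  by (rule card_exchange) (use fin_nbhd[OF assms] in \<open>auto simp: nbhd_def\<close>)

lemma nbhd_submodular_strict:
  assumes "edge_set E" "x \<in> nbhd E Y" "x \<in> nbhd E Z" "x \<notin> nbhd E (Y \<inter> Z)"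
  shows "card (nbhd E (Y \<inter> Z)) + card (nbhd E (Y \<union> Z)) < card (nbhd E Y) + card (nbhd E Z)"
  by (rule card_exchange_strict[where x=x]) (use fin_nbhd[OF assms(1)] assms in \<open>auto simp: nbhd_def\<close>)

definition sep :: "'a set set \<Rightarrow> 'a set \<Rightarrow> 'a set \<Rightarrow> bool" where
  "sep E A B \<longleftrightarrow> A \<subseteq> V \<and> B \<subseteq> V \<and> A \<inter> B = {} \<and> (\<forall>a\<in>A. \<forall>b\<in>B. {a, b} \<notin> E)"

text \<open>
  The order of a separation, with a surcharge \<open>j\<close> when it separates vertices of \<open>X\<close>. The
  surcharge is what the induction on the tree raises: it gives room to spare against separations
  that leave \<open>X\<close> on one side, which are the ones not controlled by counting vertices of \<open>X\<close>.
\<close>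

definition sep_cost :: "nat \<Rightarrow> 'a set \<Rightarrow> 'a set \<Rightarrow> nat" where
  "sep_cost j A B = card (V - (A \<union> B)) + (if A \<inter> X \<noteq> {} \<and> B \<inter> X \<noteq> {} then j else 0)"

text \<open>
  For \<open>j = 0\<close> and more than \<open>t\<close> vertices this is \<open>t\<close>-connectivity.
\<close>

definition sep_bound :: "nat \<Rightarrow> nat \<Rightarrow> 'a set set \<Rightarrow> bool" where
  "sep_bound j t E \<longleftrightarrow> (\<forall>A B. sep E A B \<and> A \<noteq> {} \<and> B \<noteq> {} \<longrightarrow> t \<le> sep_cost j A B)"

lemma sep_commute: "sep E A B \<longleftrightarrow> sep E B A"
  unfolding sep_def by (metis Int_commute insert_commute)

lemma sep_cost_commute: "sep_cost j A B = sep_cost j B A"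
  unfolding sep_cost_def by (auto simp: Un_commute)

lemma sep_boundD: "sep_bound j t E \<Longrightarrow> sep E A B \<Longrightarrow> A \<noteq> {} \<Longrightarrow> B \<noteq> {} \<Longrightarrow> t \<le> sep_cost j A B"
  unfolding sep_bound_def by blast

text \<open>
  For the surcharge: if one corner separates \<open>X\<close> then so does one of the two given
  separations, and if both corners do then both given separations do.
\<close>

lemma sep_cost_corners:
  assumes "A1 \<inter> B1 = {}" "A2 \<inter> B2 = {}"
  shows "sep_cost j (A1 \<inter> A2) (B1 \<union> B2) + sep_cost j (A1 \<union> A2) (B1 \<inter> B2) \<le> sep_cost j A1 B1 + sep_cost j A2 B2"
proof -
  let ?S = "\<lambda>A B. V - (A \<union> B)"
  have "card (?S (A1 \<inter> A2) (B1 \<union> B2)) + card (?S (A1 \<union> A2) (B1 \<inter> B2))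
      \<le> card (?S A1 B1) + card (?S A2 B2)"
    by (rule card_exchange) (use fin_V assms in auto)
  moreover have "(if (A1 \<inter> A2) \<inter> X \<noteq> {} \<and> (B1 \<union> B2) \<inter> X \<noteq> {} then j else 0)
     + (if (A1 \<union> A2) \<inter> X \<noteq> {} \<and> (B1 \<inter> B2) \<inter> X \<noteq> {} then j else 0)
     \<le> (if A1 \<inter> X \<noteq> {} \<and> B1 \<inter> X \<noteq> {} then j else 0) + (if A2 \<inter> X \<noteq> {} \<and> B2 \<inter> X \<noteq> {} then j else 0)"
    by (cases "A1 \<inter> X = {}"; cases "A2 \<inter> X = {}"; cases "B1 \<inter> X = {}"; cases "B2 \<inter> X = {}") auto
  ultimately show ?thesis unfolding sep_cost_def by linarith
qed

text \<open>
  A separation that is new after the removal of \<open>xy\<close> must have \<open>x\<close> and \<open>y\<close> on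
  different sides.
\<close>

lemma bad_sep:
  assumes "sep_bound j t E" "\<not> sep_bound j t (E - {{x, y}})"
  obtains A B where "sep (E - {{x, y}}) A B" "x \<in> A" "y \<in> B" "sep_cost j A B < t"
proof -
  obtain A B where AB: "sep (E - {{x, y}}) A B" "A \<noteq> {}" "B \<noteq> {}" "sep_cost j A B < t"
    using assms(2) unfolding sep_bound_def by (auto simp: not_le)
  have "\<not> sep E A B" using assms(1) AB sep_boundD by (meson leD)
  then obtain a b where ab: "a \<in> A" "b \<in> B" "{a, b} \<in> E"
    using AB(1) unfolding sep_def by blast
  then have "{a, b} = {x, y}" using AB(1) unfolding sep_def by blast
  then consider "a = x" "b = y" | "a = y" "b = x" by (auto simp: doubleton_eq_iff)
  then show ?thesis
  proof cases
    case 1 then show ?thesis using that AB ab by blast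
  next
    case 2 then show ?thesis using that[of B A] AB ab sep_commute sep_cost_commute by metis
  qed
qed

lemma sep_nbhd: "edge_set E \<Longrightarrow> sep E A B \<Longrightarrow> nbhd E A \<subseteq> V - (A \<union> B)"
  unfolding sep_def nbhd_def by (auto dest: edge_setD)

text \<open>
  If \<open>B1\<close> and \<open>B2\<close> met, the corner \<open>(A1 \<union> A2, B1 \<inter> B2)\<close> would be a separation in \<open>E\<close> itself,
  because neither \<open>y1\<close> nor \<open>y2\<close> lies in \<open>B1 \<inter> B2\<close>; so it costs at least \<open>t\<close>, and the opposite
  corner costs at most \<open>t - 2\<close>. The only edges of \<open>E\<close> across that corner are \<open>x y1\<close> and \<open>x y2\<close>, so moving
  \<open>x\<close> into the separator gives a separation in \<open>E\<close> that is still too cheap. Hence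
  \<open>A1 \<inter> A2 = {x}\<close>, and then \<open>x\<close> has at most \<open>t\<close> neighbours.
\<close>

lemma bad_sides_disjoint:
  assumes g: "edge_set E" and con: "sep_bound j t E" and y: "y1 \<noteq> y2"
    and s1: "sep (E - {{x, y1}}) A1 B1" and x1: "x \<in> A1" "y1 \<in> B1" and c1: "sep_cost j A1 B1 < t"
    and s2: "sep (E - {{x, y2}}) A2 B2" and x2: "x \<in> A2" "y2 \<in> B2" and c2: "sep_cost j A2 B2 < t"
    and deg: "t < card (nbrs E x)"
  shows "B1 \<inter> B2 = {}"
proof (rule ccontr)
  assume ne: "B1 \<inter> B2 \<noteq> {}"
  note s = s1[unfolded sep_def] s2[unfolded sep_def]
  have d: "A1 \<inter> B1 = {}" "A2 \<inter> B2 = {}" using s by auto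
  have only1: "{a, b} = {x, y1}" if "a \<in> A1" "b \<in> B1" "{a,b} \<in> E" for a b using s that by blast
  have only2: "{a, b} = {x, y2}" if "a \<in> A2" "b \<in> B2" "{a,b} \<in> E" for a b using s that by blast
  have only1': "a = x \<and> b = y1" if "a \<in> A1" "b \<in> B1" "{a,b} \<in> E" for a b
    using only1[OF that] x1 d that by (auto simp: doubleton_eq_iff)
  have only2': "a = x \<and> b = y2" if "a \<in> A2" "b \<in> B2" "{a,b} \<in> E" for a b
    using only2[OF that] x2 d that by (auto simp: doubleton_eq_iff)
  have "sep E (A1 \<union> A2) (B1 \<inter> B2)"
    unfolding sep_def
  proof (intro conjI ballI notI)
    fix a b assume "a \<in> A1 \<union> A2" "b \<in> B1 \<inter> B2" "{a,b} \<in> E"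
    then show False using only1' only2' x1 x2 y by blast
  qed (use s d in auto)
  then have "t \<le> sep_cost j (A1 \<union> A2) (B1 \<inter> B2)"
    using con ne x1 by (auto intro!: sep_boundD)
  with sep_cost_corners[OF d, of j] c1 c2
  have c: "sep_cost j (A1 \<inter> A2) (B1 \<union> B2) + 2 \<le> t" by linarith
  \<comment> \<open>Otherwise \<open>x\<close> can move into the separator, which costs at most one.\<close>
  have A: "A1 \<inter> A2 = {x}"
  proof (rule ccontr)
    assume "A1 \<inter> A2 \<noteq> {x}"
    then have ne': "A1 \<inter> A2 - {x} \<noteq> {}" using x1 x2 by auto
    have "sep E (A1 \<inter> A2 - {x}) (B1 \<union> B2)"
      unfolding sep_def
    proof (intro conjI ballI notI)
      fix a b assume "a \<in> A1 \<inter> A2 - {x}" "b \<in> B1 \<union> B2" "{a,b} \<in> E"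
      then show False using only1' only2' by blast
    qed (use s d in auto)
    then have "t \<le> sep_cost j (A1 \<inter> A2 - {x}) (B1 \<union> B2)"
      using con ne' x1 by (auto intro!: sep_boundD)
    also have "\<dots> \<le> sep_cost j (A1 \<inter> A2) (B1 \<union> B2) + 1"
    proof -
      have "V - (A1 \<inter> A2 - {x} \<union> (B1 \<union> B2)) \<subseteq> insert x (V - (A1 \<inter> A2 \<union> (B1 \<union> B2)))" by auto
      then have "card (V - (A1 \<inter> A2 - {x} \<union> (B1 \<union> B2))) \<le> card (insert x (V - (A1 \<inter> A2 \<union> (B1 \<union> B2))))"
        by (intro card_mono) (use fin_V in auto)
      also have "\<dots> \<le> card (V - (A1 \<inter> A2 \<union> (B1 \<union> B2))) + 1"
        using fin_V by (simp add: card_insert_if)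
      finally show ?thesis unfolding sep_cost_def by auto
    qed
    finally show False using c by simp
  qed
  have "nbrs E x \<subseteq> insert y1 (insert y2 (V - (A1 \<inter> A2 \<union> (B1 \<union> B2))))"
  proof
    fix b assume b: "b \<in> nbrs E x"
    then have "{x,b} \<in> E" "b \<in> V" "b \<noteq> x" using g by (auto simp: nbrs_def dest: edge_setD)
    then show "b \<in> insert y1 (insert y2 (V - (A1 \<inter> A2 \<union> (B1 \<union> B2))))"
      using only1'[of x b] only2'[of x b] x1 x2 A by blast
  qed
  then have "card (nbrs E x) \<le> card (insert y1 (insert y2 (V - (A1 \<inter> A2 \<union> (B1 \<union> B2)))))"
    by (intro card_mono) (use fin_V in auto)
  also have "\<dots> \<le> card (V - (A1 \<inter> A2 \<union> (B1 \<union> B2))) + 2"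
    using fin_V by (simp add: card_insert_if)
  also have "\<dots> \<le> t" using c unfolding sep_cost_def by simp
  finally show False using deg by simp
qed

text \<open>
  The form in which bad separations are counted: one side for each bad neighbour of \<open>x\<close>, pairwise
  disjoint, and containing no further neighbour of \<open>x\<close>.
\<close>

lemma bad_sides:
  assumes g: "edge_set E" and con: "sep_bound j t E" and T: "T \<subseteq> nbrs E x" "t < card (nbrs E x)"
    and bad: "\<And>y. y \<in> T \<Longrightarrow> \<not> sep_bound j t (E - {{x, y}})"
  obtains P R where "\<And>y. y \<in> T \<Longrightarrow> sep (E - {{x, y}}) (P y) (R y)"
    "\<And>y. y \<in> T \<Longrightarrow> x \<in> P y" "\<And>y. y \<in> T \<Longrightarrow> y \<in> R y" "\<And>y. y \<in> T \<Longrightarrow> sep_cost j (P y) (R y) < t"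
    "\<And>y y'. y \<in> T \<Longrightarrow> y' \<in> T \<Longrightarrow> y \<noteq> y' \<Longrightarrow> R y \<inter> R y' = {}"
    "\<And>y. y \<in> T \<Longrightarrow> nbrs E x \<inter> R y = {y}"
proof -
  have "\<forall>y\<in>T. \<exists>PR. sep (E - {{x, y}}) (fst PR) (snd PR) \<and> x \<in> fst PR \<and> y \<in> snd PR \<and> sep_cost j (fst PR) (snd PR) < t"
    using bad_sep[OF con bad] by (metis fst_conv snd_conv)
  then obtain PR where PR: "\<And>y. y \<in> T \<Longrightarrow> sep (E - {{x, y}}) (fst (PR y)) (snd (PR y)) \<and> x \<in> fst (PR y) \<and> y \<in> snd (PR y) \<and> sep_cost j (fst (PR y)) (snd (PR y)) < t"
    by metis
  show ?thesis
  proof (rule that[of "\<lambda>y. fst (PR y)" "\<lambda>y. snd (PR y)"])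
    fix y y' assume y: "y \<in> T" "y' \<in> T" "y \<noteq> y'"
    show "snd (PR y) \<inter> snd (PR y') = {}"
      using bad_sides_disjoint[OF g con y(3)] PR[OF y(1)] PR[OF y(2)] T(2) by blast
  next
    fix y assume y: "y \<in> T"
    show "nbrs E x \<inter> snd (PR y) = {y}"
    proof
      show "{y} \<subseteq> nbrs E x \<inter> snd (PR y)" using PR[OF y] y T by auto
      show "nbrs E x \<inter> snd (PR y) \<subseteq> {y}"
      proof
        fix z assume z: "z \<in> nbrs E x \<inter> snd (PR y)"
        then have "{x,z} \<in> E" by (simp add: nbrs_def)
        moreover have "{x,z} \<notin> E - {{x,y}}" using PR[OF y] z unfolding sep_def by blast
        ultimately show "z \<in> {y}" by (auto simp: doubleton_eq_iff)
      qed
    qed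
  qed (use PR in auto)
qed

end

section \<open>Trees grown leaf by leaf\<close>

text \<open>
  Trees as they are used by the induction. Every tree arises in this way, as \<open>tree_imp_itree\<close>
  shows.
\<close>

inductive itree :: "'b set \<Rightarrow> 'b set set \<Rightarrow> bool" where
  single: "itree {v} {}"
| leaf: "itree VT ET \<Longrightarrow> u \<in> VT \<Longrightarrow> l \<notin> VT \<Longrightarrow> itree (insert l VT) (insert {u, l} ET)"

lemma itree_props: "itree VT ET \<Longrightarrow> finite VT \<and> VT \<noteq> {} \<and> finite ET \<and> ET \<subseteq> nsets VT 2 \<and> card VT = Suc (card ET)"
proof (induction rule: itree.induct)
  case (single v) then show ?case by simp
next
  case (leaf VT ET u l)
  have "{u,l} \<notin> ET" using leaf by (auto simp: nsets_def)
  moreover have "{u,l} \<in> nsets (insert l VT) 2" using leaf by (auto simp: nsets_def card_insert_if)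
  moreover have "nsets VT 2 \<subseteq> nsets (insert l VT) 2" by (auto simp: nsets_def)
  ultimately show ?case using leaf by auto
qed

definition image_edges :: "('b \<Rightarrow> 'a) \<Rightarrow> 'b set set \<Rightarrow> 'a set set" where
  "image_edges f ET = (\<lambda>e. f ` e) ` ET"

definition embeds :: "('b \<Rightarrow> 'a) \<Rightarrow> 'b set \<Rightarrow> 'b set set \<Rightarrow> 'a set \<Rightarrow> 'a set set \<Rightarrow> bool" where
  "embeds f VT ET D E \<longleftrightarrow> inj_on f VT \<and> f ` VT \<subseteq> D \<and> image_edges f ET \<subseteq> E"

lemma image_edges_extend:
  assumes "ET \<subseteq> nsets VT 2" "u \<in> VT" "l \<notin> VT"
  shows "image_edges (f(l := y)) (insert {u, l} ET) = insert {f u, y} (image_edges f ET)"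
proof -
  have "f(l := y) ` e = f ` e" if "e \<in> ET" for e
    using that assms by (intro image_cong) (auto simp: nsets_def)
  moreover have "f(l := y) ` {u,l} = {f u, y}" using assms by auto
  ultimately show ?thesis unfolding image_edges_def by simp
qed

lemma embeds_extend:
  assumes "ET \<subseteq> nsets VT 2" "u \<in> VT" "l \<notin> VT" "embeds f VT ET D E"
    and "y \<in> D" "y \<notin> f ` VT" "{f u, y} \<in> E"
  shows "embeds (f(l := y)) (insert l VT) (insert {u, l} ET) D E"
proof -
  have "inj_on (f(l := y)) (insert l VT)"
    using assms(3,4,6) by (auto simp: embeds_def inj_on_def)
  moreover have "f(l := y) ` insert l VT \<subseteq> D" using assms by (auto simp: embeds_def)
  moreover have "image_edges (f(l := y)) (insert {u, l} ET) \<subseteq> E"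
    unfolding image_edges_extend[OF assms(1-3)] using assms(4,7) by (auto simp: embeds_def)
  ultimately show ?thesis by (simp add: embeds_def)
qed

lemma embeds_mono: "embeds f VT ET D E \<Longrightarrow> D \<subseteq> D' \<Longrightarrow> embeds f VT ET D' E"
  by (auto simp: embeds_def)

lemma image_edges_inside:
  assumes "ET \<subseteq> nsets VT 2" "embeds f VT ET D E" "{u,v} \<in> image_edges f ET"
  shows "u \<in> f ` VT \<and> v \<in> f ` VT"
proof -
  obtain e where "e \<in> ET" "{u,v} = f ` e" using assms(3) by (auto simp: image_edges_def)
  then show ?thesis using assms(1) by (fastforce simp: nsets_def)
qed

definition is_star :: "'b \<Rightarrow> 'b set \<Rightarrow> 'b set set \<Rightarrow> bool" where
  "is_star c VT ET \<longleftrightarrow> c \<in> VT \<and> ET = (\<lambda>v. {c, v}) ` (VT - {c})"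

text \<open>
  A tree has one edge less than it has vertices, so if one vertex is adjacent to all others
  there is no further edge.
\<close>

lemma is_star_from_degree:
  assumes T: "itree VT ET" "u \<in> VT" and many: "card VT - 1 \<le> card {v \<in> VT - {u}. {u, v} \<in> ET}"
  shows "is_star u VT ET"
proof -
  have p: "finite VT" "finite ET" "card VT = Suc (card ET)" using itree_props[OF T(1)] by auto
  have "{v \<in> VT - {u}. {u, v} \<in> ET} = VT - {u}"
    by (rule card_seteq) (use p T(2) many in auto)
  then have sub: "(\<lambda>v. {u, v}) ` (VT - {u}) \<subseteq> ET" by blast
  have "inj_on (\<lambda>v. {u, v}) (VT - {u})" by (auto simp: inj_on_def doubleton_eq_iff)
  then have "card ((\<lambda>v. {u, v}) ` (VT - {u})) = card ET" using p T(2) by (simp add: card_image)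
  then have "(\<lambda>v. {u, v}) ` (VT - {u}) = ET" using card_seteq[OF p(2) sub] by simp
  then show ?thesis using T(2) by (auto simp: is_star_def)
qed

lemma is_star_leaf: "is_star u VT ET \<Longrightarrow> l \<notin> VT \<Longrightarrow> is_star u (insert l VT) (insert {u, l} ET)"
  by (auto simp: is_star_def)

lemma edge_in_verts: "edges H \<subseteq> nsets (verts H) 2 \<Longrightarrow> {a, b} \<in> edges H \<Longrightarrow> a \<in> verts H \<and> b \<in> verts H"
  by (auto simp: nsets_def)

text \<open>
  Connectedness is only used in this form: it turns walks into separations and cuts.
\<close>

lemma connected_graph_iff_crossing:
  assumes "edges H \<subseteq> nsets (verts H) 2"
  shows "connected_graph H \<longleftrightarrow> verts H \<noteq> {} \<and>
    (\<forall>A. A \<subseteq> verts H \<and> A \<noteq> {} \<and> A \<noteq> verts H \<longrightarrow> (\<exists>a\<in>A. \<exists>b\<in>verts H - A. {a, b} \<in> edges H))"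
    (is "?L \<longleftrightarrow> ?R")
proof
  let ?r = "{(x, y). {x, y} \<in> edges H}"
  show ?R if L: ?L
  proof (intro conjI allI impI, goal_cases)
    case 1 then show ?case using L by (simp add: connected_graph_def)
  next
    case (2 A)
    then obtain u v where uv: "u \<in> A" "v \<in> verts H - A" by blast
    show ?case
    proof (rule ccontr)
      assume neg: "\<not> ?thesis"
      have "(u, v) \<in> ?r\<^sup>*" using L uv 2 unfolding connected_graph_def by blast
      then have "v \<in> A"
      proof (induction rule: rtrancl_induct)
        case (step y z)
        then show ?case using neg edge_in_verts[OF assms, of y z] by blast
      qed (use uv in simp)
      then show False using uv by blast
    qed
  qed
  show ?L if R: ?R
    unfolding connected_graph_def
  proof (intro conjI ballI)
    fix u v assume uv: "u \<in> verts H" "v \<in> verts H"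
    define A where "A = {w \<in> verts H. (u, w) \<in> ?r\<^sup>*}"
    have "A = verts H"
    proof (rule ccontr)
      assume "A \<noteq> verts H"
      moreover have "u \<in> A" "A \<subseteq> verts H" using uv by (auto simp: A_def)
      ultimately obtain a b where ab: "a \<in> A" "b \<in> verts H - A" "{a, b} \<in> edges H" using R by blast
      then have "(u, b) \<in> ?r\<^sup>*" by (auto simp: A_def intro: rtrancl_into_rtrancl)
      then show False using ab by (simp add: A_def)
    qed
    then show "(u, v) \<in> ?r\<^sup>*" using uv by (auto simp: A_def)
  qed (use R in blast)
qed

lemma itree_path:
  assumes "itree VT ET" "u \<in> VT" "v \<in> VT"
  shows "\<exists>p. p \<noteq> [] \<and> hd p = u \<and> last p = v \<and> distinct p \<and> set p \<subseteq> VT \<and> successively (\<lambda>a b. {a, b} \<in> ET) p"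
  using assms
proof (induction arbitrary: u v rule: itree.induct)
  case (single w)
  then show ?case by (intro exI[of _ "[w]"]) auto
next
  case (leaf VT ET w l)
  have ext: "successively (\<lambda>a b. {a, b} \<in> insert {w, l} ET) p" if "successively (\<lambda>a b. {a, b} \<in> ET) p" for p
    using that by (rule successively_mono) auto
  consider "u \<in> VT" "v \<in> VT" | "u = l" "v = l" | "u = l" "v \<in> VT" | "u \<in> VT" "v = l"
    using leaf.prems by auto
  then show ?case
  proof cases
    case 1
    then show ?thesis using leaf.IH[OF 1] ext by blast
  next
    case 2
    then show ?thesis by (intro exI[of _ "[l]"]) auto
  next
    case 3
    obtain p where p: "p \<noteq> []" "hd p = w" "last p = v" "distinct p" "set p \<subseteq> VT" "successively (\<lambda>a b. {a, b} \<in> ET) p"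
      using leaf.IH[OF leaf.hyps(2) 3(2)] by blast
    have "successively (\<lambda>a b. {a, b} \<in> insert {w, l} ET) (l # p)"
      using ext[OF p(6)] p(1,2) by (cases p) (auto simp: insert_commute)
    then show ?thesis using p 3 leaf.hyps(3) by (intro exI[of _ "l # p"]) auto
  next
    case 4
    obtain p where p: "p \<noteq> []" "hd p = u" "last p = w" "distinct p" "set p \<subseteq> VT" "successively (\<lambda>a b. {a, b} \<in> ET) p"
      using leaf.IH[OF 4(1) leaf.hyps(2)] by blast
    have "successively (\<lambda>a b. {a, b} \<in> insert {w, l} ET) (p @ [l])"
      using ext[OF p(6)] p(1,3) by (auto simp: successively_append_iff)
    then show ?thesis using p 4 leaf.hyps(3) by (intro exI[of _ "p @ [l]"]) auto
  qed
qed

text \<open>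
  A largest leaf-by-leaf subtree of \<open>T\<close> spans \<open>T\<close>, since otherwise an edge leaving its vertex set
  would extend it. An edge of \<open>T\<close> outside it would close a cycle with the path between its ends.
\<close>

lemma tree_imp_itree:
  assumes "tree T"
  shows "itree (verts T) (edges T)"
proof -
  have sg: "finite (verts T)" "edges T \<subseteq> nsets (verts T) 2" and con: "connected_graph T"
    and acyc: "\<nexists>c. is_cycle T c"
    using assms by (auto simp: tree_def simple_graph_def)
  define P where "P n \<longleftrightarrow> (\<exists>A F. itree A F \<and> A \<subseteq> verts T \<and> F \<subseteq> edges T \<and> card A = n)" for n
  obtain r where r: "r \<in> verts T" using con by (auto simp: connected_graph_def)
  have P1: "P (card {r})" unfolding P_def using itree.single[of r] r by blast
  have bound: "n \<le> card (verts T)" if "P n" for n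
    using that sg(1) card_mono unfolding P_def by blast
  obtain n where n: "P n" "\<And>n'. P n' \<Longrightarrow> n' \<le> n"
    using Greatest_le_nat[of P _ "card (verts T)"] GreatestI_nat[of P _ "card (verts T)"] P1 bound by metis
  obtain A F where AF: "itree A F" "A \<subseteq> verts T" "F \<subseteq> edges T" "card A = n" using n(1) unfolding P_def by blast
  have pA: "finite A" "A \<noteq> {}" "F \<subseteq> nsets A 2" using itree_props[OF AF(1)] by auto
  have AV: "A = verts T"
  proof (rule ccontr)
    assume "A \<noteq> verts T"
    then obtain a b where ab: "a \<in> A" "b \<in> verts T - A" "{a, b} \<in> edges T"
      using con pA AF(2) connected_graph_iff_crossing[OF sg(2)] by blast
    have "itree (insert b A) (insert {a, b} F)" using itree.leaf[OF AF(1) ab(1)] ab by blast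
    then have "P (card (insert b A))" unfolding P_def using AF ab by blast
    then show False using n(2) AF(4) pA ab by fastforce
  qed
  have "edges T \<subseteq> F"
  proof
    fix e assume e: "e \<in> edges T"
    then obtain u v where uv: "e = {u, v}" "u \<noteq> v" "u \<in> verts T" "v \<in> verts T"
      using sg(2) by (auto simp: nsets_def card_2_iff)
    show "e \<in> F"
    proof (rule ccontr)
      assume ne: "e \<notin> F"
      obtain p where p: "p \<noteq> []" "hd p = u" "last p = v" "distinct p" "set p \<subseteq> A" "successively (\<lambda>a b. {a, b} \<in> F) p"
        using itree_path[OF AF(1)] uv AV by metis
      have step: "{p ! i, p ! Suc i} \<in> F" if "Suc i < length p" for i
        using p(6) that by (simp add: successively_conv_nth)
      have ends: "p ! 0 = u" "p ! (length p - 1) = v" using p by (auto simp: hd_conv_nth last_conv_nth)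
      have "length p \<noteq> 1" using ends uv by auto
      moreover have "length p \<noteq> 2" using step[of 0] ends ne uv by auto
      moreover have "length p \<noteq> 0" using p by simp
      ultimately have len: "length p \<ge> 3" by linarith
      have "is_cycle T p"
        unfolding is_cycle_def
      proof (intro conjI allI impI)
        fix i assume i: "i < length p"
        show "{p ! i, p ! (Suc i mod length p)} \<in> edges T"
        proof (cases "Suc i < length p")
          case True
          then show ?thesis using step AF(3) by auto
        next
          case False
          then have "Suc i = length p" using i by simp
          then have "i = length p - 1" "Suc i mod length p = 0" by auto
          then show ?thesis using ends e uv by (simp add: insert_commute)
        qed
      qed (use len p AV in auto)
      then show False using acyc by blast
    qed
  qed
  then have "F = edges T" using AF(3) by blast
  then show ?thesis using AF(1) AV by simp
qed

lemma image_tree: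
  assumes T: "tree T" and inj: "inj_on f (verts T)"
  defines "T' \<equiv> \<lparr>verts = f ` verts T, edges = image_edges f (edges T)\<rparr>"
  shows "tree T'" and "isomorphic T' T"
proof -
  have sg: "finite (verts T)" "edges T \<subseteq> nsets (verts T) 2" and con: "connected_graph T"
    and acyc: "\<nexists>c. is_cycle T c"
    using T by (auto simp: tree_def simple_graph_def)
  let ?g = "inv_into (verts T) f"
  have g: "?g (f v) = v" if "v \<in> verts T" for v using that inj by simp
  have gf: "?g ` f ` e = e" if "e \<in> edges T" for e
    using that sg(2) g by (force simp: nsets_def image_image)
  have e_iff: "{u, v} \<in> image_edges f (edges T) \<longleftrightarrow> {?g u, ?g v} \<in> edges T"
    if "u \<in> f ` verts T" "v \<in> f ` verts T" for u v
  proof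
    assume "{u, v} \<in> image_edges f (edges T)"
    then obtain e where e: "e \<in> edges T" "{u, v} = f ` e" by (auto simp: image_edges_def)
    have "?g ` {u, v} = e" unfolding e(2) by (rule gf[OF e(1)])
    then show "{?g u, ?g v} \<in> edges T" using e(1) by simp
  next
    assume "{?g u, ?g v} \<in> edges T"
    then have "f ` {?g u, ?g v} \<in> image_edges f (edges T)" unfolding image_edges_def by blast
    then show "{u, v} \<in> image_edges f (edges T)" using that by (auto simp: f_inv_into_f)
  qed
  have bij: "bij_betw ?g (f ` verts T) (verts T)" using inj by (simp add: bij_betw_inv_into inj_on_imp_bij_betw)
  then show "isomorphic T' T" unfolding isomorphic_def T'_def using e_iff by auto
  have sub: "edges T' \<subseteq> nsets (verts T') 2"
  proof
    fix e' assume "e' \<in> edges T'"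
    then obtain e where e: "e \<in> edges T" "e' = f ` e" by (auto simp: T'_def image_edges_def)
    then have "e \<subseteq> verts T" "finite e" "card e = 2" using sg(2) by (auto simp: nsets_def)
    then show "e' \<in> nsets (verts T') 2"
      using e inj by (auto simp: nsets_def T'_def card_image inj_on_subset)
  qed
  have c1: "connected_graph T'"
    unfolding connected_graph_iff_crossing[OF sub]
  proof (intro conjI allI impI)
    show "verts T' \<noteq> {}" using con by (auto simp: T'_def connected_graph_def)
    fix A assume A: "A \<subseteq> verts T' \<and> A \<noteq> {} \<and> A \<noteq> verts T'"
    define B where "B = {v \<in> verts T. f v \<in> A}"
    have "B \<subseteq> verts T" "B \<noteq> {}" "B \<noteq> verts T" using A by (auto simp: B_def T'_def)
    then obtain a b where ab: "a \<in> B" "b \<in> verts T - B" "{a, b} \<in> edges T"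
      using con connected_graph_iff_crossing[OF sg(2)] by blast
    have "f ` {a, b} \<in> image_edges f (edges T)" unfolding image_edges_def using ab(3) by (rule imageI)
    then have "{f a, f b} \<in> edges T'" by (simp add: T'_def)
    then show "\<exists>a\<in>A. \<exists>b\<in>verts T' - A. {a, b} \<in> edges T'"
      using ab by (intro bexI[of _ "f a"] bexI[of _ "f b"]) (auto simp: B_def T'_def)
  qed
  have c2: "\<not> is_cycle T' c" for c
  proof
    assume c: "is_cycle T' c"
    then have cv: "set c \<subseteq> f ` verts T" "length c \<ge> 3" "distinct c" by (auto simp: is_cycle_def T'_def)
    have "is_cycle T (map ?g c)"
      unfolding is_cycle_def
    proof (intro conjI allI impI)
      show "distinct (map ?g c)" using cv bij by (auto simp: distinct_map bij_betw_def intro: inj_on_subset)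
      show "set (map ?g c) \<subseteq> verts T" using cv(1) bij by (auto simp: bij_betw_def)
      fix i assume i: "i < length (map ?g c)"
      then have j: "Suc i mod length c < length c" by (intro mod_less_divisor) auto
      have "{c ! i, c ! (Suc i mod length c)} \<in> image_edges f (edges T)"
        using c i by (simp add: is_cycle_def T'_def)
      then show "{map ?g c ! i, map ?g c ! (Suc i mod length (map ?g c))} \<in> edges T"
        using e_iff[of "c ! i" "c ! (Suc i mod length c)"] cv(1) i j nth_mem by auto
    qed (use cv in auto)
    then show False using acyc by blast
  qed
  show "tree T'" using c1 c2 sub sg(1) by (auto simp: tree_def simple_graph_def T'_def)
qed

section \<open>Fragments and their attachments\<close>

context vertex_sets
begin

text \<open>
  Otherwise \<open>(P \<union> D, R \<inter> B)\<close> would be a separation in \<open>E\<close>, since all removed edges meet \<open>D\<close>, and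
  would cost at least \<open>t\<close>. The opposite corner costs at least \<open>K\<close> because its small
  side \<open>P \<inter> D\<close> has \<open>K\<close> neighbours. Together the corners cost less than \<open>t + K\<close>, a contradiction.
\<close>

lemma far_corner_empty:
  assumes g: "edge_set E" and con: "sep_bound j t E" and DB: "sep E D B" "sep_cost j D B \<le> K"
    and E1: "E1 \<subseteq> E" "\<And>u v. {u,v} \<in> E - E1 \<Longrightarrow> u \<in> D \<or> v \<in> D"
    and PR: "sep E1 P R" "sep_cost j P R < t" "P \<inter> D \<noteq> {}" and root: "K \<le> card (nbhd E1 (P \<inter> D))"
  shows "R \<inter> B = {}"
proof (rule ccontr)
  assume ne: "R \<inter> B \<noteq> {}"
  have g1: "edge_set E1" using g E1(1) edge_set_mono by blast
  have disj: "P \<inter> R = {}" "D \<inter> B = {}" using PR DB by (auto simp: sep_def)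
  have s1: "sep E1 (P \<inter> D) (R \<union> B)"
    using PR(1) DB(1) E1(1) unfolding sep_def by blast
  note root
  also have "card (nbhd E1 (P \<inter> D)) \<le> card (V - (P \<inter> D \<union> (R \<union> B)))"
    by (rule card_mono) (use sep_nbhd[OF g1 s1] fin_V in auto)
  also have "\<dots> \<le> sep_cost j (P \<inter> D) (R \<union> B)" unfolding sep_cost_def by simp
  finally have c1: "K \<le> sep_cost j (P \<inter> D) (R \<union> B)" .
  have s2: "sep E (P \<union> D) (R \<inter> B)"
    unfolding sep_def
  proof (intro conjI ballI notI)
    fix a b assume ab: "a \<in> P \<union> D" "b \<in> R \<inter> B" "{a,b} \<in> E"
    then have "a \<notin> D" "b \<notin> D" using DB(1) by (auto simp: sep_def)
    then have "a \<in> P" "{a,b} \<in> E1" using E1(2)[of a b] ab by auto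
    then show False using ab PR(1) by (auto simp: sep_def)
  qed (use PR DB in \<open>auto simp: sep_def\<close>)
  then have "t \<le> sep_cost j (P \<union> D) (R \<inter> B)"
    using con ne PR(3) by (intro sep_boundD) auto
  then show False using c1 sep_cost_corners[OF disj, of j] DB(2) PR(2) by linarith
qed

text \<open>
  By \<open>far_corner_empty\<close>, used for both sides, neither \<open>P\<close> nor \<open>R\<close> reaches beyond the attachment
  \<open>S\<close> of \<open>D\<close>, so the whole rest \<open>V - D - S\<close> lies in the separator. The \<open>K\<close> neighbours of \<open>R \<inter> D\<close>
  lie in \<open>S \<inter> R\<close> and in the part of the separator outside that rest. That part has at most
  \<open>K - 2\<close> vertices, because the order is less than \<open>t\<close> and the rest is not empty.
\<close>

lemma bad_sep_meets_attachment:
  assumes g: "edge_set E" and con: "sep_bound j t E"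
    and D: "D \<subseteq> V" "D \<inter> X = {}" and S: "S = nbhd E D" "card S = K" "t \<le> K" and B: "V - D - S \<noteq> {}"
    and E1: "E1 \<subseteq> E" "\<And>u v. {u,v} \<in> E - E1 \<Longrightarrow> u \<in> D \<and> v \<in> D"
    and root: "\<And>Y. Y \<noteq> {} \<Longrightarrow> Y \<subseteq> D \<Longrightarrow> K \<le> card (nbhd E1 Y)"
    and PR: "sep E1 P R" "sep_cost j P R < t" "P \<inter> D \<noteq> {}" "R \<inter> D \<noteq> {}"
  shows "2 \<le> card (S \<inter> R)"
proof -
  let ?B = "V - D - S"
  have g1: "edge_set E1" using g E1(1) edge_set_mono by blast
  have SV: "S \<subseteq> V" using S g nbhd_subset by auto
  have DS: "D \<inter> S = {}" using S by (auto simp: nbhd_def)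
  have DB: "sep E D ?B" using D S by (auto simp: sep_def nbhd_def)
  have "V - (D \<union> ?B) = S" using SV DS D by auto
  then have costDB: "sep_cost j D ?B \<le> K" using D S unfolding sep_cost_def by auto
  have meets: "u \<in> D \<or> v \<in> D" if "{u,v} \<in> E - E1" for u v using E1(2)[OF that] by blast
  note far = far_corner_empty[OF g con DB costDB E1(1) meets]
  have RB: "R \<inter> ?B = {}" using far[OF _ PR(1-3)] root[of "P \<inter> D"] PR(3) by blast
  have PB: "P \<inter> ?B = {}"
    using far[of R P] root[of "R \<inter> D"] PR sep_commute[of E1 P R] sep_cost_commute[of j P R] by auto
  \<comment> \<open>\<open>?Z\<close> is the part of the separator outside the rest \<open>?B\<close>.\<close>
  let ?Z = "V - (P \<union> R) - ?B"
  have "nbhd E1 (R \<inter> D) \<subseteq> (S \<inter> R) \<union> ?Z"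
  proof
    fix v assume "v \<in> nbhd E1 (R \<inter> D)"
    then obtain u where u: "u \<in> R" "u \<in> D" "{u,v} \<in> E1" "v \<notin> R \<inter> D" by (auto simp: nbhd_def)
    then have "v \<in> V" "v \<notin> P" using PR(1) edge_setD[OF g1] by (auto simp: sep_def insert_commute)
    moreover have "v \<notin> ?B" using u DB E1(1) unfolding sep_def by blast
    ultimately show "v \<in> (S \<inter> R) \<union> ?Z" using u by auto
  qed
  moreover have "K \<le> card (nbhd E1 (R \<inter> D))" using root PR(4) by auto
  ultimately have "K \<le> card ((S \<inter> R) \<union> ?Z)"
    using fin_V SV by (meson card_mono finite_Diff finite_Int finite_Un finite_subset le_trans)
  also have "\<dots> \<le> card (S \<inter> R) + card ?Z" by (rule card_Un_le)
  finally have a: "K \<le> card (S \<inter> R) + card ?Z" .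
  have "?Z \<union> ?B = V - (P \<union> R)" "?Z \<inter> ?B = {}" using PB RB by auto
  then have "card ?Z + card ?B = card (V - (P \<union> R))"
    using fin_V by (metis card_Un_disjoint finite_Diff)
  moreover have "card (V - (P \<union> R)) < t" using PR(2) unfolding sep_cost_def by simp
  moreover have "1 \<le> card ?B" using B fin_V by (metis One_nat_def Suc_leI card_gt_0_iff finite_Diff)
  ultimately show ?thesis using a S(3) by linarith
qed

definition expanding :: "'a set set \<Rightarrow> 'a set \<Rightarrow> nat \<Rightarrow> bool" where
  "expanding E D K \<longleftrightarrow> (\<forall>Y. Y \<noteq> {} \<and> Y \<subseteq> D \<longrightarrow> K \<le> card (nbhd E Y))"

lemma expandingD: "expanding E D K \<Longrightarrow> Y \<noteq> {} \<Longrightarrow> Y \<subseteq> D \<Longrightarrow> K \<le> card (nbhd E Y)"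
  by (auto simp: expanding_def)

text \<open>
  The situation in which the tree is placed on one side of a minimum separation. The minimum is
  taken over the subsets of \<open>D\<close>, and \<open>K\<close> may exceed the bound \<open>t\<close> for all separations.
\<close>

definition fragment :: "nat \<Rightarrow> nat \<Rightarrow> 'a set set \<Rightarrow> 'a set \<Rightarrow> nat \<Rightarrow> bool" where
  "fragment j t E D K \<longleftrightarrow> edge_set E \<and> sep_bound j t E \<and> D \<noteq> {} \<and> D \<subseteq> V - X \<and>
     card (nbhd E D) = K \<and> t \<le> K \<and> V - D - nbhd E D \<noteq> {} \<and> expanding E D K"

lemma fragment_tight_subset:
  assumes "fragment j t E D K" "Y \<noteq> {}" "Y \<subseteq> D" "card (nbhd E Y) = K"
  shows "fragment j t E Y K"
proof -
  have "nbhd E Y \<subseteq> D \<union> nbhd E D" using assms(3) by (auto simp: nbhd_def)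
  then have "V - D - nbhd E D \<subseteq> V - Y - nbhd E Y" using assms(3) by auto
  then have "V - Y - nbhd E Y \<noteq> {}" using assms(1) by (auto simp: fragment_def)
  moreover have "expanding E Y K" using assms(1,3) unfolding fragment_def expanding_def by blast
  ultimately show ?thesis using assms unfolding fragment_def by auto
qed

text \<open>
  Submodularity for \<open>Z\<close> and the tight set \<open>Y\<close>: the neighbours of \<open>Z \<union> Y\<close> are not affected by edges
  removed inside \<open>Y\<close>, so \<open>Z\<close> inherits the bound of \<open>Z \<inter> Y\<close>.
\<close>

lemma expanding_lift:
  assumes g: "edge_set E" and r: "expanding E D K" and Y: "Y \<noteq> {}" "Y \<subseteq> D" "card (nbhd E Y) = K"
    and F: "\<And>u v. {u,v} \<in> F \<Longrightarrow> u \<in> Y \<and> v \<in> Y" and rY: "expanding (E - F) Y K"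
  shows "expanding (E - F) D K"
  unfolding expanding_def
proof (intro allI impI, elim conjE)
  fix Z assume Z: "Z \<noteq> {}" "Z \<subseteq> D"
  have g': "edge_set (E - F)" using g edge_set_mono by blast
  show "K \<le> card (nbhd (E - F) Z)"
  proof (cases "Z \<inter> Y = {}")
    case True
    then have "nbhd (E - F) Z = nbhd E Z" using F by (fastforce simp: nbhd_def)
    then show ?thesis using r Z expandingD by auto
  next
    case False
    have "nbhd (E - F) (Z \<union> Y) = nbhd E (Z \<union> Y)" using F by (fastforce simp: nbhd_def)
    then have a: "K \<le> card (nbhd (E - F) (Z \<union> Y))" using r Z Y expandingD[of E D K "Z \<union> Y"] by auto
    have "nbhd (E - F) Y = nbhd E Y" using F by (fastforce simp: nbhd_def)
    then have b: "card (nbhd (E - F) Y) = K" using Y by simp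
    have c: "K \<le> card (nbhd (E - F) (Z \<inter> Y))" using expandingD[OF rY False] by auto
    show ?thesis using nbhd_submodular[OF g', of Z Y] a b c by linarith
  qed
qed

section \<open>Stars inside a fragment\<close>

definition star_edges :: "'a \<Rightarrow> 'a set \<Rightarrow> 'a set set" where
  "star_edges x L = (\<lambda>l. {x, l}) ` L"

lemma in_star_edges: "{u, v} \<in> star_edges x L \<longleftrightarrow> (u = x \<and> v \<in> L) \<or> (v = x \<and> u \<in> L)"
  by (auto simp: star_edges_def doubleton_eq_iff)

lemma star_edges_insert: "E - star_edges x (insert y L) = E - star_edges x L - {{x,y}}"
  by (auto simp: star_edges_def)

lemma nbrs_minus_star: "edge_set E \<Longrightarrow> L \<subseteq> nbrs E x \<Longrightarrow> nbrs (E - star_edges x L) x = nbrs E x - L"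
  by (auto simp: nbrs_def in_star_edges dest: edge_setD)

text \<open>
  The removed edges all contain \<open>x\<close>, so a set other than \<open>{x}\<close> and \<open>D\<close> loses at most one vertex in
  comparison with a proper subset of \<open>D\<close>, and those have one neighbour to spare. For \<open>{x}\<close> the
  degree of \<open>x\<close> pays.
\<close>

lemma expanding_minus_star:
  assumes frag: "fragment j t E D K" and proper: "expanding E D K"
    "\<And>Y. Y \<noteq> {} \<Longrightarrow> Y \<subset> D \<Longrightarrow> K < card (nbhd E Y)"
    and x: "x \<in> D" "L \<subseteq> nbrs E x \<inter> D" "card L + K \<le> card (nbrs E x)"
  shows "expanding (E - star_edges x L) D K"
  unfolding expanding_def
proof (intro allI impI, elim conjE)
  fix Y assume Y: "Y \<noteq> {}" "Y \<subseteq> D"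
  let ?E = "E - star_edges x L"
  have g: "edge_set E" using frag by (simp add: fragment_def)
  then have g': "edge_set ?E" using edge_set_mono by blast
  have finL: "finite L" using x g fin_nbrs finite_subset by blast
  have xL: "x \<notin> L" using x nbrs_subset[OF g, of x] by auto
  consider "Y = D" | "Y \<noteq> D" "Y = {x}" | "Y \<noteq> D" "Y \<noteq> {x}" "x \<in> Y" | "Y \<noteq> D" "x \<notin> Y" by auto
  then show "K \<le> card (nbhd ?E Y)"
  proof cases
    case 1
    then have "nbhd ?E Y = nbhd E Y" using x by (auto simp: nbhd_def in_star_edges)
    then show ?thesis using proper Y expandingD by metis
  next
    case 2
    have "card (nbhd ?E Y) = card (nbrs E x - L)"
      using 2 nbhd_singleton[OF g'] nbrs_minus_star[OF g] x by auto
    also have "\<dots> = card (nbrs E x) - card L" using finL x by (intro card_Diff_subset) auto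
    finally show ?thesis using x(3) by simp
  next
    case 3
    have "Suc K \<le> card (nbhd E (Y - {x}))" using proper(2)[of "Y - {x}"] 3 Y by (simp add: Suc_le_eq) blast
    also have "\<dots> \<le> card (insert x (nbhd ?E Y))"
    proof (rule card_mono)
      show "nbhd E (Y - {x}) \<subseteq> insert x (nbhd ?E Y)"
      proof
        fix v assume "v \<in> nbhd E (Y - {x})"
        then obtain u where "u \<in> Y" "u \<noteq> x" "{u,v} \<in> E" "v \<notin> Y \<or> v = x" by (auto simp: nbhd_def)
        then show "v \<in> insert x (nbhd ?E Y)" by (auto simp: nbhd_def in_star_edges)
      qed
    qed (use fin_nbhd[OF g'] in auto)
    also have "\<dots> \<le> Suc (card (nbhd ?E Y))" by (simp add: card_insert_if fin_nbhd[OF g'])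
    finally show ?thesis by simp
  next
    case 4
    have "Suc K \<le> card (nbhd E Y)" using proper(2)[of Y] 4 Y by (simp add: Suc_le_eq psubset_eq)
    also have "\<dots> \<le> card (insert x (nbhd ?E Y))"
    proof (rule card_mono)
      show "nbhd E Y \<subseteq> insert x (nbhd ?E Y)" using 4 by (auto simp: nbhd_def in_star_edges)
    qed (use fin_nbhd[OF g'] in auto)
    also have "\<dots> \<le> Suc (card (nbhd ?E Y))" by (simp add: card_insert_if fin_nbhd[OF g'])
    finally show ?thesis by simp
  qed
qed

text \<open>
  Let \<open>S\<close> be the attachment of \<open>D\<close>. Of the \<open>K\<close> vertices of \<open>S\<close> let \<open>s\<close> be not adjacent to \<open>x\<close>. Then \<open>x\<close>
  has at least \<open>s + 1\<close> candidates in \<open>D\<close>, while bad candidates need disjoint pairs of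
  vertices among these \<open>s\<close>.
\<close>

lemma star_step:
  assumes frag: "fragment j t E D K"
    and proper: "\<And>Y. Y \<noteq> {} \<Longrightarrow> Y \<subset> D \<Longrightarrow> K < card (nbhd E Y)"
    and x: "x \<in> D" "L \<subseteq> nbrs E x \<inter> D" "card L + K < card (nbrs E x)"
    and con: "sep_bound j t (E - star_edges x L)"
  shows "\<exists>y \<in> nbrs E x \<inter> D - L. sep_bound j t (E - star_edges x (insert y L))"
proof (rule ccontr)
  assume neg: "\<not> ?thesis"
  let ?E = "E - star_edges x L"
  let ?S = "nbhd E D"
  let ?T = "nbrs E x \<inter> D - L"
  have g: "edge_set E" and rt: "expanding E D K" and t: "t \<le> K" and cS: "card ?S = K" and conE: "sep_bound j t E"
    and DV: "D \<subseteq> V" "D \<inter> X = {}" and B: "V - D - ?S \<noteq> {}"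
    using frag by (auto simp: fragment_def)
  then have g': "edge_set ?E" using edge_set_mono by blast
  have finL: "finite L" using x g fin_nbrs finite_subset by blast
  have nb: "nbrs ?E x = nbrs E x - L" using nbrs_minus_star[OF g] x by auto
  have "card (nbrs ?E x) = card (nbrs E x) - card L"
    unfolding nb using finL x by (intro card_Diff_subset) auto
  then have degE: "t < card (nbrs ?E x)" using x t by simp
  have bad: "\<not> sep_bound j t (?E - {{x,y}})" if "y \<in> ?T" for y
    using neg that unfolding star_edges_insert by blast
  have "?T \<subseteq> nbrs ?E x" using nb by auto
  from bad_sides[OF g' con this degE bad] obtain P R where
    PR: "\<And>y. y \<in> ?T \<Longrightarrow> sep (?E - {{x, y}}) (P y) (R y)"
    "\<And>y. y \<in> ?T \<Longrightarrow> x \<in> P y" "\<And>y. y \<in> ?T \<Longrightarrow> y \<in> R y" "\<And>y. y \<in> ?T \<Longrightarrow> sep_cost j (P y) (R y) < t"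
    "\<And>y y'. y \<in> ?T \<Longrightarrow> y' \<in> ?T \<Longrightarrow> y \<noteq> y' \<Longrightarrow> R y \<inter> R y' = {}"
    "\<And>y. y \<in> ?T \<Longrightarrow> nbrs ?E x \<inter> R y = {y}" by blast
  \<comment> \<open>A neighbour of \<open>x\<close> in \<open>S\<close> is joined to \<open>x\<close> by an edge that has not been removed, so it is not on the side of \<open>y\<close>.\<close>
  have two: "?S \<inter> R y \<subseteq> ?S - nbrs E x \<and> 2 \<le> card (?S \<inter> R y)" if y: "y \<in> ?T" for y
  proof
    have LS: "L \<inter> ?S = {}" "y \<notin> ?S" using x y by (auto simp: nbhd_def)
    then show "?S \<inter> R y \<subseteq> ?S - nbrs E x" using PR(6)[OF y] unfolding nb by auto
    have "card (insert y L) + K \<le> card (nbrs E x)"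
      using x(3) finL y by simp
    then have rt': "expanding (E - star_edges x (insert y L)) D K"
      using expanding_minus_star[OF frag rt proper x(1)] x(2) y by auto
    show "2 \<le> card (?S \<inter> R y)"
    proof (rule bad_sep_meets_attachment[OF g conE DV refl cS t B])
      show "E - star_edges x (insert y L) \<subseteq> E" by auto
      show "u \<in> D \<and> v \<in> D" if "{u,v} \<in> E - (E - star_edges x (insert y L))" for u v
        using that x y by (auto simp: in_star_edges)
      show "K \<le> card (nbhd (E - star_edges x (insert y L)) Y)" if "Y \<noteq> {}" "Y \<subseteq> D" for Y
        using expandingD[OF rt' that] .
      show "sep (E - star_edges x (insert y L)) (P y) (R y)" using PR(1)[OF y] by (simp add: star_edges_insert)
    qed (use PR y x in blast)+
  qed
  have finN: "finite (nbrs E x)" using fin_nbrs g by blast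
  have finS: "finite ?S" using fin_nbhd g by blast
  have le: "2 * card ?T \<le> card (?S - nbrs E x)"
  proof (rule disjoint_family_count[where A="\<lambda>y. ?S \<inter> R y"])
    show "?S \<inter> R y \<inter> (?S \<inter> R y') = {}" if "y \<in> ?T" "y' \<in> ?T" "y \<noteq> y'" for y y'
      using PR(5)[OF that] by blast
  qed (use two finN finS in auto)
  have "nbrs E x \<subseteq> ?T \<union> L \<union> (?S \<inter> nbrs E x)" using x by (auto simp: nbhd_def nbrs_def)
  then have "card (nbrs E x) \<le> card (?T \<union> L \<union> (?S \<inter> nbrs E x))"
    using finN finL finS by (intro card_mono) auto
  also have "\<dots> \<le> card ?T + card L + card (?S \<inter> nbrs E x)"
    by (meson add_mono_thms_linordered_semiring(3) card_Un_le le_trans)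
  finally have "card (nbrs E x) \<le> card ?T + card L + card (?S \<inter> nbrs E x)" .
  moreover have "card (?S - nbrs E x) = K - card (?S \<inter> nbrs E x)"
    using finS cS by (metis card_Diff_subset_Int finite_Int)
  moreover have "card (?S \<inter> nbrs E x) \<le> K" using finS cS by (metis Int_lower1 card_mono)
  ultimately show False using le x(3) by linarith
qed

lemma star_deletion:
  assumes frag: "fragment j t E D K"
    and proper: "\<And>Y. Y \<noteq> {} \<Longrightarrow> Y \<subset> D \<Longrightarrow> K < card (nbhd E Y)"
    and x: "x \<in> D" "i + K \<le> card (nbrs E x)"
  shows "\<exists>L. L \<subseteq> nbrs E x \<inter> D \<and> card L = i \<and> sep_bound j t (E - star_edges x L)"
  using x(2)
proof (induction i)
  case 0
  then show ?case using frag by (intro exI[of _ "{}"]) (auto simp: star_edges_def fragment_def)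
next
  case (Suc i)
  then obtain L where L: "L \<subseteq> nbrs E x \<inter> D" "card L = i" "sep_bound j t (E - star_edges x L)" by auto
  then obtain y where y: "y \<in> nbrs E x \<inter> D - L" "sep_bound j t (E - star_edges x (insert y L))"
    using star_step[OF frag proper x(1) L(1) _ L(3)] Suc by auto
  have "finite L" using L frag fin_nbrs finite_subset unfolding fragment_def by blast
  then show ?case using y L by (intro exI[of _ "insert y L"]) auto
qed

lemma star_case:
  assumes frag: "fragment j t E D K"
    and proper: "\<And>Y. Y \<noteq> {} \<Longrightarrow> Y \<subset> D \<Longrightarrow> K < card (nbhd E Y)"
    and T: "is_star c VT ET" "finite VT" and deg: "\<And>v. v \<in> D \<Longrightarrow> K + card VT - 1 \<le> card (nbrs E v)"
  shows "\<exists>f. embeds f VT ET D E \<and> expanding (E - image_edges f ET) D K \<and> sep_bound j t (E - image_edges f ET)"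
proof -
  have g: "edge_set E" and rt: "expanding E D K" using frag by (auto simp: fragment_def)
  obtain x where x: "x \<in> D" using frag by (auto simp: fragment_def)
  have cT: "c \<in> VT" "card VT \<ge> 1" "card (VT - {c}) = card VT - 1"
    using T by (auto simp: is_star_def Suc_le_eq card_gt_0_iff)
  have d: "card VT - 1 + K \<le> card (nbrs E x)" using deg[OF x] cT by simp
  from star_deletion[OF frag proper x d] obtain L where
    L: "L \<subseteq> nbrs E x \<inter> D" "card L = card VT - 1" "sep_bound j t (E - star_edges x L)" by blast
  have finL: "finite L" using L g fin_nbrs finite_subset by blast
  obtain h where h: "bij_betw h (VT - {c}) L"
    using finL T(2) L(2) cT(3) by (metis finite_Diff finite_same_card_bij)
  define f where "f = h(c := x)"
  have xL: "x \<notin> L" using L nbrs_subset[OF g, of x] by auto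
  have hL: "h v \<in> L" if "v \<in> VT" "v \<noteq> c" for v using h that by (auto simp: bij_betw_def)
  have fe: "image_edges f ET = star_edges x L"
  proof -
    have "image_edges f ET = (\<lambda>v. {x, h v}) ` (VT - {c})"
      unfolding image_edges_def using T(1) by (auto simp: is_star_def f_def image_image)
    also have "\<dots> = star_edges x (h ` (VT - {c}))" by (auto simp: star_edges_def)
    finally show ?thesis using h by (simp add: bij_betw_def)
  qed
  have "inj_on f VT"
    using h hL xL unfolding inj_on_def bij_betw_def f_def by (metis DiffI fun_upd_apply singletonD)
  moreover have "f ` VT \<subseteq> D" using hL L x by (auto simp: f_def)
  moreover have "image_edges f ET \<subseteq> E" unfolding fe using L by (auto simp: star_edges_def nbrs_def)
  moreover have "expanding (E - image_edges f ET) D K" unfolding fe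
    by (rule expanding_minus_star[OF frag rt proper x]) (use L d in auto)
  ultimately show ?thesis unfolding embeds_def using fe L(3) by metis
qed

section \<open>Other trees inside a fragment\<close>

text \<open>
  The critical step for trees that are not stars. Here \<open>E0\<close> is what remains after the smaller tree has
  been removed inside \<open>D - {w}\<close>, and \<open>N\<close> are the neighbours of \<open>x\<close> outside that tree. Call
  \<open>Y \<subseteq> D\<close> tight if it has exactly \<open>K\<close> neighbours in \<open>E0\<close>. All tight sets contain \<open>w\<close>, so they are closed
  under intersection. Suppose that no edge \<open>xy\<close> with \<open>y\<close> in \<open>N \<inter> D\<close> can be removed. Then each
  such \<open>y\<close> has a reason: a cheap separation, a tight set containing \<open>x\<close> in which \<open>x\<close> is
  the only neighbour of \<open>y\<close> (type 1), or a tight set containing \<open>y\<close> in which \<open>y\<close> is the only neighbour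
  of \<open>x\<close> (type 2). Only one \<open>y\<close> can be of type 2. Let \<open>Yx\<close> be the least tight set containing \<open>x\<close> and
  \<open>Nx\<close> its neighbourhood. Counting cheap separations against \<open>Nx - N\<close> shows that there are none and that
  \<open>N \<inter> Yx\<close> is a single vertex \<open>y1\<close>, of type 2, so the other candidates are of type 1. Through them \<open>Yx - {x}\<close> sees
  nothing new inside \<open>D\<close>, so \<open>x\<close> has at least \<open>K - 1\<close> neighbours in the attachment \<open>S\<close> of \<open>D\<close>. By
  the choice of \<open>w\<close>, so has \<open>w\<close>, and the neighbours of \<open>w\<close> then fix the neighbourhoods of all
  tight sets up to one vertex. This leaves \<open>Yx\<close> as \<open>x\<close> together with a
  tight set in which \<open>y1\<close> is the only neighbour of \<open>x\<close>, whence the bound on the degree of \<open>x\<close>.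
\<close>

lemma free_edge_or_small_degree:
  assumes frag: "fragment j t E D K"
    and E0: "E0 \<subseteq> E" "\<And>u v. {u,v} \<in> E - E0 \<Longrightarrow> u \<in> D - {w} \<and> v \<in> D - {w}"
    and con: "sep_bound j t E0" and w: "w \<in> D" "K < card (nbrs E w)"
    and wmax: "\<And>v. v \<in> D \<Longrightarrow> card (nbrs E v \<inter> nbhd E D) \<le> card (nbrs E w \<inter> nbhd E D)"
    and r0: "expanding E0 (D - {w}) (Suc K)"
    and x: "x \<in> D" "x \<noteq> w" and N: "N \<subseteq> nbrs E0 x" "Suc K \<le> card N"
    and bad: "\<And>y. y \<in> N \<inter> D \<Longrightarrow> \<not> (expanding (E0 - {{x,y}}) D K \<and> sep_bound j t (E0 - {{x,y}}))"
  shows "card (nbrs E0 x) \<le> Suc K"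
proof -
  define S where "S = nbhd E D"
  have g: "edge_set E" and conE: "sep_bound j t E" and DV: "D \<subseteq> V" "D \<inter> X = {}" and cS: "card S = K"
    and tK: "t \<le> K" and B: "V - D - S \<noteq> {}" using frag by (auto simp: fragment_def S_def)
  have g0: "edge_set E0" using g E0(1) edge_set_mono by blast
  have SD: "S \<inter> D = {}" by (auto simp: S_def nbhd_def)
  have finS: "finite S" using fin_nbhd[OF g] by (simp add: S_def)
  have finD: "finite D" using DV fin_V finite_subset by blast
  have nbrs_E_S: "nbrs E v \<inter> S = nbrs E0 v \<inter> S" for v
    using E0 SD by (fastforce simp: nbrs_def)
  have nbrs_w: "nbrs E w = nbrs E0 w" using E0 by (fastforce simp: nbrs_def)
  \<comment> \<open>Putting \<open>w\<close> back costs one neighbour; its own edges are untouched.\<close>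
  have r: "expanding E0 D K"
    unfolding expanding_def
  proof (intro allI impI, elim conjE)
    fix Y assume Y: "Y \<noteq> {}" "Y \<subseteq> D"
    consider "w \<notin> Y" | "Y = {w}" | "w \<in> Y" "Y - {w} \<noteq> {}" by auto
    then show "K \<le> card (nbhd E0 Y)"
    proof cases
      case 1
      then have "Y \<subseteq> D - {w}" using Y by blast
      then show ?thesis using expandingD[OF r0 Y(1)] by simp
    next
      case 2 then show ?thesis using nbhd_singleton[OF g0] nbrs_w w by auto
    next
      case 3
      have "Suc K \<le> card (nbhd E0 (Y - {w}))" using expandingD[OF r0 3(2)] Y by auto
      also have "\<dots> \<le> card (insert w (nbhd E0 Y))"
        by (rule card_mono) (use fin_nbhd[OF g0] in \<open>auto simp: nbhd_def\<close>)
      also have "\<dots> \<le> Suc (card (nbhd E0 Y))" by (simp add: card_insert_if fin_nbhd[OF g0])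
      finally show ?thesis by simp
    qed
  qed
  define tight where "tight Y \<longleftrightarrow> Y \<noteq> {} \<and> Y \<subseteq> D \<and> card (nbhd E0 Y) = K" for Y
  have tight_w: "w \<in> Y" if "tight Y" for Y
    using expandingD[OF r0, of Y] that unfolding tight_def by fastforce
  have "nbhd E0 D = S" using E0 by (fastforce simp: nbhd_def S_def)
  then have tight_D: "tight D" using w cS unfolding tight_def by auto
  have tight_Int: "tight (Y \<inter> Z) \<and> nbhd E0 Y \<inter> nbhd E0 Z \<subseteq> nbhd E0 (Y \<inter> Z)" if "tight Y" "tight Z" for Y Z
  proof -
    have ne: "Y \<inter> Z \<noteq> {}" "Y \<union> Z \<noteq> {}" using that tight_w by blast+
    have sub: "Y \<inter> Z \<subseteq> D" "Y \<union> Z \<subseteq> D" using that unfolding tight_def by blast+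
    have a: "K \<le> card (nbhd E0 (Y \<inter> Z))" "K \<le> card (nbhd E0 (Y \<union> Z))"
      using expandingD[OF r ne(1) sub(1)] expandingD[OF r ne(2) sub(2)] .
    have b: "card (nbhd E0 Y) = K" "card (nbhd E0 Z) = K" using that unfolding tight_def by blast+
    have "v \<in> nbhd E0 (Y \<inter> Z)" if v: "v \<in> nbhd E0 Y" "v \<in> nbhd E0 Z" for v
    proof (rule ccontr)
      assume "v \<notin> nbhd E0 (Y \<inter> Z)"
      then show False using nbhd_submodular_strict[OF g0 v] a b by linarith
    qed
    moreover have "card (nbhd E0 (Y \<inter> Z)) = K" using nbhd_submodular[OF g0, of Y Z] a b by linarith
    ultimately show ?thesis using ne(1) sub(1) unfolding tight_def by blast
  qed
  \<comment> \<open>An inclusion-least tight set containing \<open>x\<close>, found as one of least size.\<close>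
  obtain Yx where Yx: "tight Yx" "x \<in> Yx" and Yx_least: "\<And>Y. tight Y \<Longrightarrow> x \<in> Y \<Longrightarrow> Yx \<subseteq> Y"
  proof -
    obtain Y0 where Y0: "tight Y0 \<and> x \<in> Y0" "\<And>Y. tight Y \<and> x \<in> Y \<Longrightarrow> card Y0 \<le> card Y"
      using ex_has_least_nat[of "\<lambda>Y. tight Y \<and> x \<in> Y" D card] tight_D x by blast
    have "Y0 \<subseteq> Y" if "tight Y" "x \<in> Y" for Y
    proof -
      have "card Y0 \<le> card (Y0 \<inter> Y)" using Y0 that tight_Int by blast
      moreover have "finite Y0" using Y0 finD finite_subset unfolding tight_def by blast
      ultimately show ?thesis by (metis Int_lower1 card_seteq inf.orderI)
    qed
    then show ?thesis using that Y0 by blast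
  qed
  define Nx where "Nx = nbhd E0 Yx"
  have YxD: "Yx \<subseteq> D" and cNx: "card Nx = K" using Yx by (auto simp: tight_def Nx_def)
  have finNx: "finite Nx" using fin_nbhd[OF g0] by (simp add: Nx_def)
  have NxYx: "Nx \<inter> Yx = {}" by (auto simp: Nx_def nbhd_def)
  have Nx_out: "Nx \<subseteq> D \<union> S" using YxD E0(1) by (auto simp: Nx_def nbhd_def S_def)
  have nbrs_x: "nbrs E0 x \<subseteq> Yx \<union> Nx" using Yx(2) by (auto simp: nbrs_def Nx_def nbhd_def)
  have finN: "finite N" using N fin_nbrs[OF g0] finite_subset by blast

  \<comment> \<open>The two ways in which removing \<open>xy\<close> can leave a set with fewer than \<open>K\<close> neighbours: a tight set loses the neighbour \<open>y\<close>, or it loses the neighbour \<open>x\<close>.\<close>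
  define type1 where "type1 y \<longleftrightarrow> (\<exists>Y. tight Y \<and> x \<in> Y \<and> y \<notin> Y \<and> nbrs E0 y \<inter> Y = {x})" for y
  define type2 where "type2 y \<longleftrightarrow> (\<exists>Y. tight Y \<and> y \<in> Y \<and> x \<notin> Y \<and> nbrs E0 x \<inter> Y = {y})" for y
  have types: "type1 y \<or> type2 y" if y: "y \<in> N" and nr: "\<not> expanding (E0 - {{x,y}}) D K" for y
  proof -
    obtain Y where Y: "Y \<noteq> {}" "Y \<subseteq> D" "card (nbhd (E0 - {{x,y}}) Y) < K"
      using nr unfolding expanding_def by (auto simp: not_le)
    let ?b = "nbhd (E0 - {{x,y}}) Y"
    have K: "K \<le> card (nbhd E0 Y)" using expandingD[OF r] Y by blast
    have finb: "finite ?b" using fin_nbhd[of "E0 - {{x,y}}"] edge_set_mono[OF g0] by blast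
    have "\<not> nbhd E0 Y \<subseteq> ?b" using K Y(3) finb by (meson card_mono le_trans not_le)
    then obtain v where v: "v \<in> nbhd E0 Y" "v \<notin> ?b" by blast
    have vxy: "v \<in> {x,y}" using v by (auto simp: nbhd_def doubleton_eq_iff)
    have one: "nbhd E0 Y \<subseteq> insert v ?b"
    proof
      fix z assume z: "z \<in> nbhd E0 Y"
      show "z \<in> insert v ?b"
      proof (rule ccontr)
        assume n: "z \<notin> insert v ?b"
        have "z \<in> {x,y}" using z n by (auto simp: nbhd_def doubleton_eq_iff)
        moreover have "{x,y} \<inter> Y \<noteq> {}" using z n by (auto simp: nbhd_def doubleton_eq_iff)
        ultimately show False using n vxy z v by (auto simp: nbhd_def)
      qed
    qed
    then have "card (nbhd E0 Y) \<le> card (insert v ?b)" using finb by (intro card_mono) auto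
    then have "card (nbhd E0 Y) \<le> Suc (card ?b)" using finb by (simp add: card_insert_if split: if_splits)
    then have tY: "tight Y" using K Y by (auto simp: tight_def)
    consider "v = y" | "v = x" using vxy by auto
    then show ?thesis
    proof cases
      case 1
      then have "y \<notin> Y" using v by (auto simp: nbhd_def)
      moreover have "nbrs E0 y \<inter> Y = {x}"
        using v 1 by (auto simp: nbhd_def nbrs_def insert_commute doubleton_eq_iff)
      ultimately show ?thesis using tY unfolding type1_def by blast
    next
      case 2
      then have "x \<notin> Y" using v by (auto simp: nbhd_def)
      moreover have "nbrs E0 x \<inter> Y = {y}"
        using v 2 by (auto simp: nbhd_def nbrs_def insert_commute doubleton_eq_iff)
      ultimately show ?thesis using tY unfolding type2_def by blast
    qed
  qed
  \<comment> \<open>The intersection of two type 2 sets is tight and has \<open>x\<close> as a neighbour, through a vertex that must be both \<open>y\<close> and \<open>y'\<close>.\<close>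
  have type2_unique: "y = y'" if ty: "type2 y" "type2 y'" for y y'
  proof -
    obtain Y where Y: "tight Y" "x \<notin> Y" "nbrs E0 x \<inter> Y = {y}" using ty(1) unfolding type2_def by blast
    obtain Y' where Y': "tight Y'" "x \<notin> Y'" "nbrs E0 x \<inter> Y' = {y'}" using ty(2) unfolding type2_def by blast
    have "x \<in> nbhd E0 Y" "x \<in> nbhd E0 Y'" using Y Y' by (auto simp: nbhd_def nbrs_def insert_commute)
    then have "x \<in> nbhd E0 (Y \<inter> Y')" using tight_Int[OF Y(1) Y'(1)] by blast
    then obtain z where "z \<in> Y \<inter> Y'" "z \<in> nbrs E0 x" by (auto simp: nbhd_def nbrs_def insert_commute)
    then have "z \<in> nbrs E0 x \<inter> Y" "z \<in> nbrs E0 x \<inter> Y'" by blast+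
    then show ?thesis unfolding Y(3) Y'(3) by simp
  qed
  have type1_Yx: "y \<notin> Yx \<and> nbrs E0 y \<inter> Yx \<subseteq> {x}" if "type1 y" for y
    using that Yx_least unfolding type1_def by blast

  \<comment> \<open>The candidates for which only a cheap separation forbids the removal.\<close>
  define H where "H = {y \<in> N \<inter> D. expanding (E0 - {{x,y}}) D K}"
  have HN: "H \<subseteq> nbrs E0 x" "H \<subseteq> N \<inter> D" using N by (auto simp: H_def)
  have Hbad: "\<not> sep_bound j t (E0 - {{x,y}})" if "y \<in> H" for y using bad that by (auto simp: H_def)
  have tdeg: "t < card (nbrs E0 x)"
    using N card_mono[OF fin_nbrs[OF g0] N(1)] tK by simp
  from bad_sides[OF g0 con HN(1) tdeg Hbad] obtain P R where
    PR: "\<And>y. y \<in> H \<Longrightarrow> sep (E0 - {{x, y}}) (P y) (R y)"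
    "\<And>y. y \<in> H \<Longrightarrow> x \<in> P y" "\<And>y. y \<in> H \<Longrightarrow> y \<in> R y" "\<And>y. y \<in> H \<Longrightarrow> sep_cost j (P y) (R y) < t"
    "\<And>y y'. y \<in> H \<Longrightarrow> y' \<in> H \<Longrightarrow> y \<noteq> y' \<Longrightarrow> R y \<inter> R y' = {}"
    "\<And>y. y \<in> H \<Longrightarrow> nbrs E0 x \<inter> R y = {y}" by blast
  \<comment> \<open>The side of \<open>y\<close> contains two vertices of \<open>S\<close>. It does not reach beyond \<open>Yx\<close> and \<open>Nx\<close>, so both lie in \<open>Nx\<close>, and they are not neighbours of \<open>x\<close>.\<close>
  have two: "S \<inter> R y \<subseteq> Nx - N \<and> 2 \<le> card (S \<inter> R y)" if y: "y \<in> H" for y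
  proof
    let ?E1 = "E0 - {{x,y}}"
    have yD: "y \<in> D" and ry: "expanding ?E1 D K" using y by (auto simp: H_def)
    show "2 \<le> card (S \<inter> R y)"
    proof (rule bad_sep_meets_attachment[OF g conE DV S_def cS tK B])
      show "u \<in> D \<and> v \<in> D" if "{u,v} \<in> E - ?E1" for u v
        using that E0(2)[of u v] x yD by (auto simp: doubleton_eq_iff)
      show "K \<le> card (nbhd ?E1 Y)" if "Y \<noteq> {}" "Y \<subseteq> D" for Y using expandingD[OF ry that] .
    qed (use PR y x yD E0 in blast)+
    have s: "sep E0 Yx (V - Yx - Nx)" using YxD DV by (auto simp: sep_def nbhd_def Nx_def)
    have NxV: "Nx \<subseteq> V" using nbhd_subset[OF g0] by (auto simp: Nx_def)
    have "V - (Yx \<union> (V - Yx - Nx)) = Nx" using NxV NxYx by auto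
    then have c: "sep_cost j Yx (V - Yx - Nx) \<le> K" using cNx DV YxD unfolding sep_cost_def by auto
    have "R y \<inter> (V - Yx - Nx) = {}"
    proof (rule far_corner_empty[OF g0 con s c])
      show "u \<in> Yx \<or> v \<in> Yx" if "{u,v} \<in> E0 - ?E1" for u v using that Yx by (auto simp: doubleton_eq_iff)
      show "P y \<inter> Yx \<noteq> {}" using PR(2)[OF y] Yx(2) by auto
      have "P y \<inter> Yx \<subseteq> D" using YxD by auto
      then show "K \<le> card (nbhd ?E1 (P y \<inter> Yx))" using expandingD[OF ry \<open>P y \<inter> Yx \<noteq> {}\<close>] by simp
      show "sep ?E1 (P y) (R y)" "sep_cost j (P y) (R y) < t" using PR(1)[OF y] PR(4)[OF y] .
    qed auto
    moreover have "R y \<subseteq> V" using PR(1)[OF y] by (auto simp: sep_def)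
    ultimately have "R y \<subseteq> Yx \<union> Nx" by blast
    moreover have "s \<notin> N" if s: "s \<in> S \<inter> R y" for s
    proof
      assume "s \<in> N"
      then have "s \<in> nbrs E0 x \<inter> R y" using s N(1) by auto
      then have "s = y" unfolding PR(6)[OF y] by simp
      then show False using s yD SD by auto
    qed
    ultimately show "S \<inter> R y \<subseteq> Nx - N" using YxD SD by auto
  qed
  have finH: "finite H" using HN finN finite_subset by blast
  have cH: "2 * card H \<le> card (Nx - N)"
  proof (rule disjoint_family_count[where A="\<lambda>y. S \<inter> R y"])
    show "S \<inter> R y \<inter> (S \<inter> R y') = {}" if "y \<in> H" "y' \<in> H" "y \<noteq> y'" for y y'
      using PR(5)[OF that] by blast
  qed (use two finH finNx in auto)
  have "N = (N \<inter> Yx) \<union> (N \<inter> Nx)" using N nbrs_x by blast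
  then have "card N \<le> card (N \<inter> Yx) + card (N \<inter> Nx)" by (metis card_Un_le)
  moreover have "card (N \<inter> Nx) + card (Nx - N) = K"
    using card_Int_Diff[OF finNx, of N] cNx by (simp add: Int_commute)
  \<comment> \<open>\<open>N\<close> has more than \<open>K = |Nx|\<close> elements and lies in \<open>Yx \<union> Nx\<close>.\<close>
  ultimately have cNY: "Suc (card (Nx - N)) \<le> card (N \<inter> Yx)" using N(2) by linarith
  have NY: "y \<in> H \<or> type2 y" if "y \<in> N \<inter> Yx" for y
    using that types[of y] type1_Yx[of y] YxD by (auto simp: H_def)
  have "card (N \<inter> Yx) \<le> card H + 1"
  proof (cases "\<exists>y. type2 y")
    case True
    then obtain y where "type2 y" by blast
    then have "N \<inter> Yx \<subseteq> insert y H" using NY type2_unique by blast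
    then have "card (N \<inter> Yx) \<le> card (insert y H)" using finH by (intro card_mono) auto
    also have "\<dots> \<le> card H + 1" using finH by (simp add: card_insert_if)
    finally show ?thesis .
  next
    case False
    then have "N \<inter> Yx \<subseteq> H" using NY by blast
    then have "card (N \<inter> Yx) \<le> card H" using finH by (intro card_mono) auto
    then show ?thesis by simp
  qed
  \<comment> \<open>With \<open>h = |H|\<close> the last two estimates give \<open>1 + 2h \<le> 1 + |Nx - N| \<le> |N \<inter> Yx| \<le> h + 1\<close>.\<close>
  then have "card H = 0" "card (Nx - N) = 0" "card (N \<inter> Yx) = 1" using cNY cH by linarith+
  then have H0: "H = {}" and NxN: "Nx \<subseteq> N" and "\<exists>y. N \<inter> Yx = {y}"
    using finH finNx by (auto simp: card_1_singleton_iff)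
  then obtain y1 where y1: "N \<inter> Yx = {y1}" by blast
  have t2: "type2 y1" using NY y1 H0 by blast
  \<comment> \<open>Every vertex of \<open>Nx\<close> inside \<open>D\<close> is a candidate of type 1.\<close>
  have only_x: "nbrs E0 v \<inter> Yx \<subseteq> {x}" if v: "v \<in> Nx \<inter> D" for v
  proof -
    have "v \<in> N \<inter> D" using v NxN by blast
    moreover have "v \<noteq> y1" using v y1 NxYx by blast
    ultimately have "type1 v" using types[of v] H0 t2 type2_unique[of v y1] unfolding H_def by blast
    then show ?thesis using type1_Yx by blast
  qed
  define A where "A = nbrs E w \<inter> S"
  have finA: "finite A" using finS by (simp add: A_def)
  have NxS: "Nx \<inter> S \<subseteq> nbrs E x \<inter> S" using NxN N(1) nbrs_E_S[of x] by blast
  have xle: "card (Nx \<inter> S) \<le> card A"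
  proof -
    have "card (Nx \<inter> S) \<le> card (nbrs E x \<inter> S)" using NxS finS by (intro card_mono) auto
    also have "\<dots> \<le> card A" using wmax[OF x(1)] by (simp add: A_def S_def)
    finally show ?thesis .
  qed
  have wYx: "w \<in> Yx - {x}" using tight_w[OF Yx(1)] x by blast
  \<comment> \<open>The set \<open>Yx - {x}\<close> contains \<open>w\<close>, so it is not empty; its neighbours are \<open>x\<close> and vertices of \<open>Nx\<close> in \<open>S\<close>.\<close>
  have "K \<le> Suc (card (Nx \<inter> S))"
  proof -
    have "nbhd E0 (Yx - {x}) \<subseteq> insert x (Nx \<inter> S)"
    proof
      fix v assume "v \<in> nbhd E0 (Yx - {x})"
      then obtain z where z: "z \<in> Yx" "z \<noteq> x" "{z,v} \<in> E0" "v \<notin> Yx - {x}" by (auto simp: nbhd_def)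
      show "v \<in> insert x (Nx \<inter> S)"
      proof (cases "v = x")
        case False
        then have vN: "v \<in> Nx" using z by (auto simp: Nx_def nbhd_def)
        moreover have "z \<in> nbrs E0 v" using z by (simp add: nbrs_def insert_commute)
        ultimately have "v \<notin> D" using only_x[of v] z by blast
        then show ?thesis using vN Nx_out by blast
      qed simp
    qed
    then have "card (nbhd E0 (Yx - {x})) \<le> card (insert x (Nx \<inter> S))" using finNx by (intro card_mono) auto
    moreover have "K \<le> card (nbhd E0 (Yx - {x}))" using expandingD[OF r, of "Yx - {x}"] wYx YxD by blast
    ultimately show ?thesis using finNx by (simp add: card_insert_if split: if_splits)
  qed
  then have KA: "K \<le> Suc (card A)" using xle by simp
  \<comment> \<open>Tight sets contain \<open>w\<close>, and hence have all of \<open>A\<close> as neighbours: at least \<open>K - 1\<close> of the \<open>K\<close> neighbours they have.\<close>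
  have A_nbhd: "A \<subseteq> nbhd E0 Y" if "tight Y" for Y
  proof
    fix v assume "v \<in> A"
    then have "v \<in> S" "{w,v} \<in> E0" using nbrs_w by (auto simp: A_def nbrs_def)
    moreover have "w \<in> Y" "Y \<subseteq> D" using tight_w that by (auto simp: tight_def)
    ultimately show "v \<in> nbhd E0 Y" using SD by (auto simp: nbhd_def)
  qed
  have xA: "x \<notin> A" using x SD by (auto simp: A_def)
  have nbhd_eq: "nbhd E0 Y = insert x A" if "tight Y" "x \<in> nbhd E0 Y" for Y
  proof (rule sym, rule card_seteq)
    show "card (nbhd E0 Y) \<le> card (insert x A)" using KA that xA finA by (simp add: tight_def)
  qed (use A_nbhd that fin_nbhd[OF g0] in auto)
  obtain Y1 where Y1: "tight Y1" "y1 \<in> Y1" "x \<notin> Y1" "nbrs E0 x \<inter> Y1 = {y1}"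
    using t2 unfolding type2_def by blast
  have xy1: "{y1, x} \<in> E0" using Y1(4) by (auto simp: nbrs_def insert_commute)
  have "x \<in> nbhd E0 Y1" using Y1(2,3) xy1 by (auto simp: nbhd_def)
  then have "card (insert x A) = K" using nbhd_eq[OF Y1(1)] Y1(1) by (simp add: tight_def)
  then have cA: "Suc (card A) = K" using xA finA by simp
  define Y2 where "Y2 = Y1 \<inter> Yx"
  have Y2: "tight Y2" using tight_Int Y1 Yx by (simp add: Y2_def)
  have "y1 \<in> Y2" "x \<notin> Y2" using y1 Y1 by (auto simp: Y2_def)
  then have bdY2: "nbhd E0 Y2 = insert x A" using nbhd_eq[OF Y2] xy1 by (auto simp: nbhd_def)
  have "Nx \<inter> S = A"
  proof (rule sym, rule card_seteq)
    show "A \<subseteq> Nx \<inter> S" using A_nbhd[OF Yx(1)] by (auto simp: A_def Nx_def)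
  qed (use finS xle in auto)
  \<comment> \<open>What is left of \<open>Yx\<close> avoids \<open>w\<close>, so it would need \<open>K + 1\<close> neighbours, but it sees only \<open>x\<close> and \<open>A\<close>.\<close>
  have YxY2: "Yx \<subseteq> insert x Y2"
  proof (rule ccontr)
    assume "\<not> ?thesis"
    then have ne: "Yx - Y2 - {x} \<noteq> {}" by auto
    have "w \<in> Y2" using tight_w Y2 by blast
    then have "Suc K \<le> card (nbhd E0 (Yx - Y2 - {x}))" using expandingD[OF r0 ne] YxD by blast
    also have "\<dots> \<le> card (insert x A)"
    proof (rule card_mono)
      show "nbhd E0 (Yx - Y2 - {x}) \<subseteq> insert x A"
      proof
        fix v assume "v \<in> nbhd E0 (Yx - Y2 - {x})"
        then obtain z where z: "z \<in> Yx - Y2 - {x}" "{z,v} \<in> E0" "v \<notin> Yx - Y2 - {x}" by (auto simp: nbhd_def)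
        then have zv: "z \<in> nbrs E0 v" by (simp add: nbrs_def insert_commute)
        consider "v \<in> Nx" | "v = x" | "v \<in> Y2" using z by (auto simp: Nx_def nbhd_def)
        then show "v \<in> insert x A"
        proof cases
          case 1
          then have "v \<notin> D" using only_x[of v] z zv by blast
          then show ?thesis using 1 Nx_out \<open>Nx \<inter> S = A\<close> by blast
        next
          case 3
          then have "z \<in> nbhd E0 Y2" using z by (auto simp: nbhd_def insert_commute)
          then have "z \<in> A" using bdY2 z by blast
          then show ?thesis using z YxD SD by (auto simp: A_def)
        qed simp
      qed
    qed (use finA in auto)
    also have "\<dots> = K" using cA xA finA by simp
    finally show False by simp
  qed
  have "nbrs E0 x \<subseteq> insert y1 Nx"
  proof
    fix v assume v: "v \<in> nbrs E0 x"
    then have "v \<noteq> x" using nbrs_subset[OF g0] by blast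
    then have "v \<in> Nx \<or> v \<in> Y1" using v nbrs_x YxY2 by (auto simp: Y2_def)
    then show "v \<in> insert y1 Nx" using v Y1(4) by blast
  qed
  then have "card (nbrs E0 x) \<le> card (insert y1 Nx)" using finNx by (intro card_mono) auto
  then show ?thesis using cNx finNx by (simp add: card_insert_if split: if_splits)
qed

text \<open>
  At most \<open>|VT| - 1\<close> neighbours of a vertex of the embedded tree lie in the tree.
\<close>

lemma free_nbrs:
  assumes g: "edge_set E" and T: "itree VT ET" "u \<in> VT" and f: "embeds f VT ET D E"
  shows "nbrs E (f u) - f ` VT \<subseteq> nbrs (E - image_edges f ET) (f u)"
    and "card (nbrs E (f u)) \<le> card (nbrs E (f u) - f ` VT) + (card VT - 1)"
proof -
  have p: "finite VT" "ET \<subseteq> nsets VT 2" using itree_props[OF T(1)] by auto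
  show "nbrs E (f u) - f ` VT \<subseteq> nbrs (E - image_edges f ET) (f u)"
    using image_edges_inside[OF p(2) f] by (auto simp: nbrs_def)
  have "card (nbrs E (f u)) \<le> card ((nbrs E (f u) - f ` VT) \<union> f ` (VT - {u}))"
  proof (rule card_mono)
    show "nbrs E (f u) \<subseteq> (nbrs E (f u) - f ` VT) \<union> f ` (VT - {u})" using nbrs_subset[OF g, of "f u"] by auto
  qed (use p fin_nbrs[OF g] in auto)
  also have "\<dots> \<le> card (nbrs E (f u) - f ` VT) + card (f ` (VT - {u}))" by (rule card_Un_le)
  also have "card (f ` (VT - {u})) \<le> card (VT - {u})" using p by (intro card_image_le) auto
  also have "card (VT - {u}) = card VT - 1" using T(2) by simp
  finally show "card (nbrs E (f u)) \<le> card (nbrs E (f u) - f ` VT) + (card VT - 1)" by simp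
qed

lemma nbrs_after_removal:
  assumes g: "edge_set E" and T: "itree VT ET" "u \<in> VT" and f: "embeds f VT ET D E"
  shows "card (nbrs E (f u)) \<le> card (nbrs (E - image_edges f ET) (f u)) + card {v \<in> VT - {u}. {u, v} \<in> ET}"
proof -
  let ?E0 = "E - image_edges f ET"
  let ?M = "{v \<in> VT - {u}. {u, v} \<in> ET}"
  have p: "finite VT" "ET \<subseteq> nsets VT 2" using itree_props[OF T(1)] by auto
  have inj: "inj_on f VT" using f by (simp add: embeds_def)
  have "nbrs E (f u) \<subseteq> nbrs ?E0 (f u) \<union> f ` ?M"
  proof
    fix v' assume v': "v' \<in> nbrs E (f u)"
    show "v' \<in> nbrs ?E0 (f u) \<union> f ` ?M"
    proof (cases "{f u, v'} \<in> image_edges f ET")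
      case True
      then obtain e where e: "e \<in> ET" "f ` e = {f u, v'}" by (auto simp: image_edges_def)
      then obtain a b where ab: "e = {a,b}" "a \<noteq> b" "a \<in> VT" "b \<in> VT"
        using p(2) by (auto simp: nsets_def card_2_iff)
      then have "f u = f a \<and> v' = f b \<or> f u = f b \<and> v' = f a" using e by (auto simp: doubleton_eq_iff)
      then have "u = a \<and> v' = f b \<or> u = b \<and> v' = f a" using inj_onD[OF inj] ab T(2) by metis
      then show ?thesis using e ab by (auto simp: insert_commute)
    next
      case False
      then show ?thesis using v' by (auto simp: nbrs_def)
    qed
  qed
  then have "card (nbrs E (f u)) \<le> card (nbrs ?E0 (f u) \<union> f ` ?M)"
    using p fin_nbrs[of ?E0] edge_set_mono[OF g] by (intro card_mono) auto
  also have "\<dots> \<le> card (nbrs ?E0 (f u)) + card (f ` ?M)" by (rule card_Un_le)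
  also have "card (f ` ?M) \<le> card ?M" using p by (intro card_image_le) auto
  finally show ?thesis by simp
qed

lemma minus_image_edges_extend:
  assumes "ET \<subseteq> nsets VT 2" "u \<in> VT" "l \<notin> VT"
  shows "E - image_edges (f(l := y)) (insert {u, l} ET) = E - image_edges f ET - {{f u, y}}"
  unfolding image_edges_extend[OF assms] by auto

text \<open>
  The vertex \<open>w\<close> is chosen with as many neighbours in the attachment of \<open>D\<close> as possible. Since
  proper subsets of \<open>D\<close> have more than \<open>K\<close> neighbours, \<open>D - {w}\<close> is again a fragment, with \<open>K + 1\<close>.
\<close>

lemma nonstar_case:
  assumes frag: "fragment j t E D K"
    and proper: "\<And>Y. Y \<noteq> {} \<Longrightarrow> Y \<subset> D \<Longrightarrow> K < card (nbhd E Y)"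
    and T: "itree VT ET" "u \<in> VT" "l \<notin> VT" and nonstar: "\<not> is_star u VT ET"
    and deg: "\<And>v. v \<in> D \<Longrightarrow> K + card VT \<le> card (nbrs E v)"
    and IH: "\<And>D' K'. fragment j t E D' K' \<Longrightarrow> (\<And>v. v \<in> D' \<Longrightarrow> K' + card VT - 1 \<le> card (nbrs E v)) \<Longrightarrow>
      \<exists>f. embeds f VT ET D' E \<and> expanding (E - image_edges f ET) D' K' \<and> sep_bound j t (E - image_edges f ET)"
  shows "\<exists>f. embeds f (insert l VT) (insert {u, l} ET) D E \<and>
    expanding (E - image_edges f (insert {u, l} ET)) D K \<and> sep_bound j t (E - image_edges f (insert {u, l} ET))"
proof -
  let ?S = "nbhd E D"
  have g: "edge_set E" and DV: "D \<subseteq> V" "D \<inter> X = {}" "D \<noteq> {}" and cS: "card ?S = K"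
    and B: "V - D - ?S \<noteq> {}" and conE: "sep_bound j t E" and tK: "t \<le> K"
    using frag by (auto simp: fragment_def)
  have p: "finite VT" "ET \<subseteq> nsets VT 2" "card VT \<ge> 1" using itree_props[OF T(1)] by auto
  have finD: "finite D" using DV fin_V finite_subset by blast
  define c where "c v = card (nbrs E v \<inter> ?S)" for v
  obtain w where w: "w \<in> D" "\<And>v. v \<in> D \<Longrightarrow> c v \<le> c w"
  proof -
    have "Max (c ` D) \<in> c ` D" using finD DV by simp
    then obtain w where "w \<in> D" "c w = Max (c ` D)" by auto
    then show ?thesis using that[of w] finD by simp
  qed
  have ne: "D - {w} \<noteq> {}"
  proof
    assume "D - {w} = {}"
    then have "nbrs E w \<subseteq> ?S" using w(1) by (auto simp: nbrs_def nbhd_def dest: edge_setD[OF g])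
    then have "card (nbrs E w) \<le> K" using cS fin_nbhd[OF g] by (metis card_mono)
    then show False using deg[OF w(1)] p by simp
  qed
  have sub: "nbhd E (D - {w}) \<subseteq> insert w ?S" by (auto simp: nbhd_def)
  have "card (nbhd E (D - {w})) \<le> card (insert w ?S)" using sub fin_nbhd[OF g] by (intro card_mono) auto
  also have "\<dots> \<le> Suc K" using cS fin_nbhd[OF g] by (simp add: card_insert_if)
  finally have cw: "card (nbhd E (D - {w})) = Suc K" using proper[OF ne] w(1) by (simp add: le_Suc_eq) fastforce
  have "V - D - ?S \<subseteq> V - (D - {w}) - nbhd E (D - {w})" using sub w(1) by auto
  then have B': "V - (D - {w}) - nbhd E (D - {w}) \<noteq> {}" using B by auto
  have rE: "expanding E (D - {w}) (Suc K)"
    unfolding expanding_def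
  proof (intro allI impI, elim conjE)
    fix Y assume "Y \<noteq> {}" "Y \<subseteq> D - {w}"
    moreover from this have "Y \<subset> D" using w(1) by auto
    ultimately show "Suc K \<le> card (nbhd E Y)" using proper[of Y] by simp
  qed
  have frag': "fragment j t E (D - {w}) (Suc K)"
    unfolding fragment_def using g conE ne DV cw tK B' rE by auto
  have deg': "Suc K + card VT - 1 \<le> card (nbrs E v)" if "v \<in> D - {w}" for v using deg[of v] that by simp
  obtain f where f: "embeds f VT ET (D - {w}) E" "expanding (E - image_edges f ET) (D - {w}) (Suc K)"
    "sep_bound j t (E - image_edges f ET)" using IH[OF frag' deg'] by blast
  let ?E0 = "E - image_edges f ET"
  let ?N = "nbrs E (f u) - f ` VT"
  have x: "f u \<in> D" "f u \<noteq> w" using f(1) T(2) by (auto simp: embeds_def)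
  have N: "?N \<subseteq> nbrs ?E0 (f u)" using free_nbrs(1)[OF g T(1,2) f(1)] .
  have cN: "Suc K \<le> card ?N" using free_nbrs(2)[OF g T(1,2) f(1)] deg[OF x(1)] p by linarith
  have removed: "a \<in> D - {w} \<and> b \<in> D - {w}" if "{a,b} \<in> E - ?E0" for a b
  proof -
    have "a \<in> f ` VT \<and> b \<in> f ` VT" using image_edges_inside[OF p(2) f(1)] that by blast
    then show ?thesis using f(1) by (auto simp: embeds_def)
  qed
  have "\<exists>y \<in> ?N \<inter> D. expanding (?E0 - {{f u,y}}) D K \<and> sep_bound j t (?E0 - {{f u,y}})"
  proof (rule ccontr)
    assume neg: "\<not> ?thesis"
    have "card (nbrs ?E0 (f u)) \<le> Suc K"
    proof (rule free_edge_or_small_degree[OF frag _ removed f(3) w(1) _ _ f(2) x N cN])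
      show "K < card (nbrs E w)" using deg[OF w(1)] p by simp
      show "card (nbrs E v \<inter> ?S) \<le> card (nbrs E w \<inter> ?S)" if "v \<in> D" for v using w(2)[OF that] by (simp add: c_def)
    qed (use neg in auto)
    \<comment> \<open>At most \<open>K + 1\<close> of the at least \<open>K + |VT|\<close> edges at \<open>f u\<close> remain, so \<open>u\<close> has \<open>|VT| - 1\<close> edges in the tree.\<close>
    then have "card VT - 1 \<le> card {v \<in> VT - {u}. {u, v} \<in> ET}"
      using nbrs_after_removal[OF g T(1,2) f(1)] deg[OF x(1)] by linarith
    then show False using is_star_from_degree[OF T(1,2)] nonstar by blast
  qed
  then obtain y where y: "y \<in> ?N" "y \<in> D" "expanding (?E0 - {{f u,y}}) D K" "sep_bound j t (?E0 - {{f u,y}})" by blast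
  have "embeds (f(l := y)) (insert l VT) (insert {u, l} ET) D E"
    by (rule embeds_extend[OF p(2) T(2,3) embeds_mono[OF f(1)]]) (use y in \<open>auto simp: nbrs_def\<close>)
  then show ?thesis using y(3,4) unfolding minus_image_edges_extend[OF p(2) T(2,3), symmetric] by blast
qed

text \<open>
  Induction on the tree, for all \<open>D\<close> and \<open>K\<close>, and for each tree on the size of \<open>D\<close>: a proper tight
  subset of \<open>D\<close> replaces \<open>D\<close>.
\<close>

theorem tree_in_fragment:
  assumes "itree VT ET"
  shows "\<And>D K. fragment j t E D K \<Longrightarrow> (\<And>v. v \<in> D \<Longrightarrow> K + card VT - 1 \<le> card (nbrs E v)) \<Longrightarrow>
    \<exists>f. embeds f VT ET D E \<and> expanding (E - image_edges f ET) D K \<and> sep_bound j t (E - image_edges f ET)"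
  using assms
proof (induction rule: itree.induct)
  case (single v)
  then obtain x where "x \<in> D" by (auto simp: fragment_def)
  then show ?case using single by (intro exI[of _ "\<lambda>_. x"]) (auto simp: embeds_def image_edges_def fragment_def)
next
  case (leaf VT ET u l)
  let ?VT = "insert l VT" and ?ET = "insert {u, l} ET"
  have p: "finite VT" "ET \<subseteq> nsets VT 2" using itree_props[OF leaf.hyps(1)] by auto
  have p': "finite ?VT" "?ET \<subseteq> nsets ?VT 2"
    using itree_props[OF itree.leaf[OF leaf.hyps]] by auto
  have cV: "card ?VT = Suc (card VT)" using p leaf.hyps by simp
  show ?case using leaf.prems
  proof (induction "card D" arbitrary: D rule: less_induct)
    case less
    have g: "edge_set E" and rt: "expanding E D K" and DV: "D \<subseteq> V" using less.prems(1) by (auto simp: fragment_def)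
    have finD: "finite D" using DV fin_V finite_subset by blast
    show ?case
    proof (cases "\<exists>Y. Y \<noteq> {} \<and> Y \<subset> D \<and> card (nbhd E Y) = K")
      case True
      then obtain Y where Y: "Y \<noteq> {}" "Y \<subset> D" "card (nbhd E Y) = K" by blast
      then have YD: "Y \<subseteq> D" "card Y < card D" using finD by (auto intro: psubset_card_mono)
      have "fragment j t E Y K" using fragment_tight_subset[OF less.prems(1) Y(1) YD(1) Y(3)] .
      from less.hyps[OF YD(2) this] less.prems(2) YD(1)
      obtain f where f: "embeds f ?VT ?ET Y E" "expanding (E - image_edges f ?ET) Y K" "sep_bound j t (E - image_edges f ?ET)"
        by blast
      have "a \<in> Y \<and> b \<in> Y" if "{a,b} \<in> image_edges f ?ET" for a b
        using image_edges_inside[OF p'(2) f(1) that] f(1) by (auto simp: embeds_def)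
      then have "expanding (E - image_edges f ?ET) D K" using expanding_lift[OF g rt Y(1) YD(1) Y(3) _ f(2)] by blast
      then show ?thesis using f embeds_mono[OF f(1) YD(1)] by blast
    next
      case False
      have proper: "K < card (nbhd E Y)" if "Y \<noteq> {}" "Y \<subset> D" for Y
      proof -
        have "K \<le> card (nbhd E Y)" using expandingD[OF rt that(1)] that(2) by auto
        moreover have "card (nbhd E Y) \<noteq> K" using False that by blast
        ultimately show ?thesis by simp
      qed
      show ?thesis
      proof (cases "is_star u VT ET")
        case True
        show ?thesis
          by (rule star_case[OF less.prems(1) proper is_star_leaf[OF True leaf.hyps(3)] p'(1) less.prems(2)])
      next
        case False
        have "K + card VT \<le> card (nbrs E v)" if "v \<in> D" for v using less.prems(2)[OF that] cV by simp
        then show ?thesis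
          by (intro nonstar_case[OF less.prems(1) proper leaf.hyps False _ leaf.IH])
      qed
    qed
  qed
qed

section \<open>Removing a tree and keeping vertex connectivity\<close>

text \<open>
  Subsets of a side that avoids \<open>X\<close> are never charged for \<open>X\<close>, so the bound on separations
  bounds their neighbourhoods.
\<close>

lemma fragment_of_sep:
  assumes g: "edge_set E" and con: "sep_bound j t E" and AB: "sep E A B" "A \<noteq> {}" "B \<noteq> {}" "A \<inter> X = {}"
    and c: "card (V - (A \<union> B)) \<le> t"
  shows "fragment j t E A t"
proof -
  have AV: "A \<subseteq> V" using AB by (auto simp: sep_def)
  have B: "B \<subseteq> V - Y - nbhd E Y" if "Y \<subseteq> A" for Y
    using AB(1) that unfolding sep_def nbhd_def by blast
  have r: "expanding E A t"
    unfolding expanding_def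
  proof (intro allI impI, elim conjE)
    fix Y assume Y: "Y \<noteq> {}" "Y \<subseteq> A"
    have "sep E Y (V - Y - nbhd E Y)" using Y AV by (auto simp: sep_def nbhd_def)
    then have "t \<le> sep_cost j Y (V - Y - nbhd E Y)" using con Y B[OF Y(2)] AB(3) by (intro sep_boundD) auto
    moreover have "V - (Y \<union> (V - Y - nbhd E Y)) = nbhd E Y"
      using nbhd_subset[OF g, of Y] by (auto simp: nbhd_def)
    moreover have "Y \<inter> X = {}" using Y AB(4) by blast
    ultimately show "t \<le> card (nbhd E Y)" by (simp add: sep_cost_def)
  qed
  have "card (nbhd E A) \<le> t"
    using card_mono[OF _ sep_nbhd[OF g AB(1)]] fin_V c by simp
  then have "card (nbhd E A) = t" using expandingD[OF r AB(2)] by simp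
  moreover have "V - A - nbhd E A \<noteq> {}" using B[of A] AB(3) by auto
  ultimately show ?thesis using g con AB(2,4) AV r unfolding fragment_def by auto
qed

text \<open>
  The second degree condition yields more free neighbours of a tree vertex than \<open>X\<close> has elements,
  which pays for the sides that meet \<open>X\<close>.
\<close>

theorem tree_keeping_sep_bound:
  assumes "itree VT ET" and g: "edge_set E"
  shows "\<And>j. sep_bound j (k + j) E \<Longrightarrow> (\<And>v. v \<in> V - X \<Longrightarrow> k + j + card VT - 1 \<le> card (nbrs E v)) \<Longrightarrow>
    (\<And>v. v \<in> V - X \<Longrightarrow> card VT - 1 + card X \<le> card (nbrs E v)) \<Longrightarrow> V - X \<noteq> {} \<Longrightarrow>
    \<exists>f. embeds f VT ET (V - X) E \<and> sep_bound j (k + j) (E - image_edges f ET)"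
  using assms(1)
proof (induction rule: itree.induct)
  case (single v)
  then obtain x where "x \<in> V - X" by blast
  then show ?case using single by (intro exI[of _ "\<lambda>_. x"]) (auto simp: embeds_def image_edges_def)
next
  case (leaf VT ET u l)
  let ?VT = "insert l VT" and ?ET = "insert {u, l} ET"
  let ?t = "k + j"
  note T = leaf.hyps
  have p: "finite VT" "ET \<subseteq> nsets VT 2" "card VT \<ge> 1" using itree_props[OF leaf.hyps(1)] by auto
  have cV: "card ?VT = Suc (card VT)" using p leaf.hyps by simp
  have deg: "?t + card VT \<le> card (nbrs E v)" "card VT + card X \<le> card (nbrs E v)" if "v \<in> V - X" for v
    using leaf.prems(2,3)[OF that] cV by auto
  have finX: "finite X" using X_sub fin_V finite_subset by blast
  show ?case
  proof (cases "sep_bound (Suc j) (k + Suc j) E")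
    case False
    then obtain A B where AB: "sep E A B" "A \<noteq> {}" "B \<noteq> {}" "sep_cost (Suc j) A B \<le> ?t"
      unfolding sep_bound_def by fastforce
    have "?t \<le> sep_cost j A B" using sep_boundD[OF leaf.prems(1) AB(1-3)] .
    \<comment> \<open>A separation charged for \<open>X\<close> gains one from \<open>j\<close> to \<open>Suc j\<close>, so the violating one is not charged.\<close>
    then have ns: "A \<inter> X = {} \<or> B \<inter> X = {}" using AB(4) by (auto simp: sep_cost_def split: if_splits)
    have c: "card (V - (A \<union> B)) \<le> ?t" using AB(4) by (simp add: sep_cost_def)
    obtain D where D: "fragment j ?t E D ?t"
      using ns fragment_of_sep[OF g leaf.prems(1) AB(1-3) _ c]
        fragment_of_sep[OF g leaf.prems(1) _ AB(3,2), OF AB(1)[unfolded sep_commute[of E A]]] c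
      by (auto simp: Un_commute)
    then have DW: "D \<subseteq> V - X" by (auto simp: fragment_def)
    have "\<exists>f. embeds f ?VT ?ET D E \<and> expanding (E - image_edges f ?ET) D ?t \<and> sep_bound j ?t (E - image_edges f ?ET)"
      by (rule tree_in_fragment[OF itree.leaf[OF T] D]) (use leaf.prems(2) DW in auto)
    then show ?thesis using embeds_mono DW by blast
  next
    case True
    have "\<exists>f. embeds f VT ET (V - X) E \<and> sep_bound (Suc j) (k + Suc j) (E - image_edges f ET)"
      by (rule leaf.IH[OF True]) (use deg leaf.prems(4) in \<open>fastforce+\<close>)
    then obtain f where f: "embeds f VT ET (V - X) E" "sep_bound (Suc j) (k + Suc j) (E - image_edges f ET)" by blast
    let ?E0 = "E - image_edges f ET"
    define x where "x = f u"
    define N where "N = nbrs E x - f ` VT"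
    define W where "W = V - X"
    have g0: "edge_set ?E0" using g edge_set_mono by blast
    have x: "x \<in> W" using f(1) T(2) by (auto simp: embeds_def x_def W_def)
    have N: "N \<subseteq> nbrs ?E0 x" using free_nbrs(1)[OF g T(1,2) f(1)] by (simp add: N_def x_def)
    have NV: "N \<subseteq> V - {x}" using nbrs_subset[OF g, of x] by (auto simp: N_def)
    have finN: "finite N" using NV fin_V finite_subset by (meson finite_Diff)
    have cN: "Suc ?t \<le> card N" "Suc (card X) \<le> card N"
      using free_nbrs(2)[OF g T(1,2) f(1)] deg[of x] x p unfolding N_def W_def x_def by linarith+
    have "card N \<le> card (V - {x})" using NV fin_V by (intro card_mono) auto
    then have cVt: "?t + 2 \<le> card V" using cN(1) x fin_V by (simp add: W_def)
    have con0: "sep_bound j ?t ?E0"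
      unfolding sep_bound_def
    proof (intro allI impI, elim conjE)
      fix A B assume "sep ?E0 A B" "A \<noteq> {}" "B \<noteq> {}"
      then have "k + Suc j \<le> sep_cost (Suc j) A B" using f(2) sep_boundD by blast
      then show "?t \<le> sep_cost j A B" by (auto simp: sep_cost_def split: if_splits)
    qed
    have "\<exists>y \<in> N \<inter> W. sep_bound j ?t (?E0 - {{x, y}})"
    proof (rule ccontr)
      assume neg: "\<not> ?thesis"
      let ?T = "N \<inter> W"
      have T: "?T \<subseteq> nbrs ?E0 x" using N by blast
      have tdeg: "?t < card (nbrs ?E0 x)" using card_mono[OF fin_nbrs[OF g0] N] cN by simp
      have bad: "\<not> sep_bound j ?t (?E0 - {{x, y}})" if "y \<in> ?T" for y using neg that by blast
      from bad_sides[OF g0 con0 T tdeg bad] obtain P R where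
        PR: "\<And>y. y \<in> ?T \<Longrightarrow> sep (?E0 - {{x, y}}) (P y) (R y)"
        "\<And>y. y \<in> ?T \<Longrightarrow> x \<in> P y" "\<And>y. y \<in> ?T \<Longrightarrow> y \<in> R y" "\<And>y. y \<in> ?T \<Longrightarrow> sep_cost j (P y) (R y) < ?t"
        "\<And>y y'. y \<in> ?T \<Longrightarrow> y' \<in> ?T \<Longrightarrow> y \<noteq> y' \<Longrightarrow> R y \<inter> R y' = {}"
        "\<And>y. y \<in> ?T \<Longrightarrow> nbrs ?E0 x \<inter> R y = {y}" by blast
      \<comment> \<open>A bad separation not charged for \<open>X\<close> would have order below \<open>?t\<close>. Moving \<open>x\<close> or \<open>y\<close> into the separator gives a separation before the removal that violates the bound for \<open>Suc j\<close>; one of the two moves is possible because there are at least \<open>?t + 2\<close> vertices.\<close>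
      have splits: "R y \<inter> X \<noteq> {}" if y: "y \<in> ?T" for y
      proof
        assume RX: "R y \<inter> X = {}"
        then have c: "card (V - (P y \<union> R y)) < ?t" using PR(4)[OF y] by (simp add: sep_cost_def)
        have s: "P y \<subseteq> V" "R y \<subseteq> V" "P y \<inter> R y = {}" and
          e: "\<And>a b. a \<in> P y \<Longrightarrow> b \<in> R y \<Longrightarrow> {a,b} \<in> ?E0 \<Longrightarrow> {a,b} = {x,y}"
          using PR(1)[OF y] unfolding sep_def by blast+
        have big: "False" if AB: "A \<noteq> {}" "B \<noteq> {}" "sep ?E0 A B" "B \<inter> X = {}" "V - (A \<union> B) \<subseteq> insert z (V - (P y \<union> R y))" for A B z
        proof -
          have "k + Suc j \<le> sep_cost (Suc j) A B" using sep_boundD[OF f(2) AB(3,1,2)] .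
          also have "\<dots> = card (V - (A \<union> B))" using AB(4) by (simp add: sep_cost_def)
          also have "\<dots> \<le> card (insert z (V - (P y \<union> R y)))" using AB(5) fin_V by (intro card_mono) auto
          also have "\<dots> \<le> Suc (card (V - (P y \<union> R y)))" using fin_V by (simp add: card_insert_if)
          finally show False using c by simp
        qed
        have e': "a = x \<and> b = y" if "a \<in> P y" "b \<in> R y" "{a,b} \<in> ?E0" for a b
          using e[OF that] that s PR(2,3)[OF y] by (auto simp: doubleton_eq_iff)
        have "R y = {y}"
        proof (rule ccontr)
          assume "R y \<noteq> {y}"
          then have ne: "R y - {y} \<noteq> {}" using PR(3)[OF y] by auto
          have "sep ?E0 (P y) (R y - {y})" unfolding sep_def using s e' by blast
          then show False using big[of "P y" "R y - {y}" y] ne RX PR(2)[OF y] by blast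
        qed
        moreover have "P y = {x}"
        proof (rule ccontr)
          assume "P y \<noteq> {x}"
          then have ne: "P y - {x} \<noteq> {}" using PR(2)[OF y] by auto
          have "sep ?E0 (P y - {x}) (R y)" unfolding sep_def using s e' by blast
          then show False using big[of "P y - {x}" "R y" x] ne RX PR(3)[OF y] by blast
        qed
        ultimately have "card (V - {x,y}) < ?t" using c by (simp add: insert_commute)
        moreover have "card V \<le> card (V - {x,y}) + card {x,y}"
        proof -
          have "card V \<le> card ((V - {x,y}) \<union> {x,y})" using fin_V by (intro card_mono) auto
          then show ?thesis using card_Un_le le_trans by blast
        qed
        moreover have "card {x,y} \<le> 2" by (simp add: card_insert_if)
        ultimately show False using cVt by linarith
      qed
      have "1 * card ?T \<le> card (X - N)"
      proof (rule disjoint_family_count[where A="\<lambda>y. R y \<inter> X"])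
        fix y assume y: "y \<in> ?T"
        have "s \<notin> N" if s: "s \<in> R y \<inter> X" for s
        proof
          assume "s \<in> N"
          then have "s \<in> nbrs ?E0 x \<inter> R y" using s N by auto
          then have "s = y" unfolding PR(6)[OF y] by simp
          then show False using s y by (auto simp: W_def)
        qed
        moreover have "1 \<le> card (R y \<inter> X)" using splits[OF y] finX by (simp add: Suc_le_eq card_gt_0_iff)
        ultimately show "R y \<inter> X \<subseteq> X - N \<and> 1 \<le> card (R y \<inter> X)" by auto
      next
        show "R y \<inter> X \<inter> (R y' \<inter> X) = {}" if "y \<in> ?T" "y' \<in> ?T" "y \<noteq> y'" for y y'
          using PR(5)[OF that] by blast
      qed (use finN finX in auto)
      moreover have "card N \<le> card ?T + card (N \<inter> X)"
      proof -
        have "N = ?T \<union> (N \<inter> X)" using NV by (auto simp: W_def)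
        then show ?thesis by (metis card_Un_le)
      qed
      moreover have "card (N \<inter> X) + card (X - N) = card X"
        using card_Int_Diff[OF finX, of N] by (simp add: Int_commute)
      ultimately show False using cN(2) by linarith
    qed
    then obtain y where y: "y \<in> N" "y \<in> W" "sep_bound j ?t (?E0 - {{x, y}})" by blast
    have "embeds (f(l := y)) ?VT ?ET (V - X) E"
      by (rule embeds_extend[OF p(2) T(2,3) f(1)]) (use y in \<open>auto simp: nbrs_def N_def W_def x_def\<close>)
    then show ?thesis using y(3) unfolding x_def minus_image_edges_extend[OF p(2) T(2,3), symmetric] by blast
  qed
qed

section \<open>Removing a tree and keeping edge connectivity\<close>

definition cut_edges :: "'a set set \<Rightarrow> 'a set \<Rightarrow> 'a set set" where
  "cut_edges E Z = {e \<in> E. e \<inter> Z \<noteq> {} \<and> e - Z \<noteq> {}}"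

lemma in_cut: "{u, v} \<in> cut_edges E Z \<longleftrightarrow> {u, v} \<in> E \<and> (u \<in> Z \<longleftrightarrow> v \<notin> Z)"
  by (auto simp: cut_edges_def)

lemma finite_edge_set: "edge_set E \<Longrightarrow> finite E"
  using fin_V by (metis finite_imp_finite_nsets finite_subset edge_set_def)

lemma fin_cut: "edge_set E \<Longrightarrow> finite (cut_edges E Z)"
  using finite_edge_set by (simp add: cut_edges_def)

lemma edge_set_subsetI:
  assumes "edge_set E" "A \<subseteq> E" "\<And>u v. {u, v} \<in> A \<Longrightarrow> {u, v} \<in> B"
  shows "A \<subseteq> B"
  using assms edge_setE by (metis subsetD subsetI)

lemma cut_submodular:
  assumes g: "edge_set E"
  shows "card (cut_edges E (Y \<inter> Z)) + card (cut_edges E (Y \<union> Z)) \<le> card (cut_edges E Y) + card (cut_edges E Z)"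
  by (rule card_exchange[OF fin_cut fin_cut]; (rule g | rule edge_set_subsetI[OF g])) (auto simp: in_cut cut_edges_def[of E])


lemma cut_posimodular:
  assumes g: "edge_set E"
  shows "card (cut_edges E (Y - Z)) + card (cut_edges E (Z - Y)) \<le> card (cut_edges E Y) + card (cut_edges E Z)"
  by (rule card_exchange[OF fin_cut fin_cut]; (rule g | rule edge_set_subsetI[OF g])) (auto simp: in_cut cut_edges_def[of E])

lemma cut_compl:
  assumes g: "edge_set E"
  shows "cut_edges E (V - Z) = cut_edges E Z"
proof -
  have same: "{u,v} \<in> cut_edges E (V - Z) \<longleftrightarrow> {u,v} \<in> cut_edges E Z" for u v
    using edge_setD[OF g, of u v] by (auto simp: in_cut)
  have sub: "cut_edges E Z' \<subseteq> E" for Z' by (auto simp: cut_edges_def)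
  show ?thesis
    using edge_set_subsetI[OF g sub] same by (intro subset_antisym) metis+
qed

definition splits :: "'a set \<Rightarrow> 'a set \<Rightarrow> bool" where
  "splits Z U \<longleftrightarrow> Z \<inter> U \<noteq> {} \<and> U - Z \<noteq> {}"

text \<open>
  Edges inside \<open>U\<close> cross only sets that split \<open>U\<close>.
\<close>

lemma cut_removed:
  assumes g: "edge_set E" and F: "\<And>u v. {u,v} \<in> F \<Longrightarrow> u \<in> U \<and> v \<in> U"
  shows "cut_edges (E - F) Z = cut_edges E Z \<or> splits Z U"
proof (rule disjCI)
  assume ns: "\<not> splits Z U"
  have same: "{u,v} \<in> cut_edges (E - F) Z \<longleftrightarrow> {u,v} \<in> cut_edges E Z" for u v
    using F[of u v] ns by (auto simp: in_cut splits_def)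
  have sub: "cut_edges (E - F) Z \<subseteq> E" "cut_edges E Z \<subseteq> E" by (auto simp: cut_edges_def)
  show "cut_edges (E - F) Z = cut_edges E Z"
    using edge_set_subsetI[OF g sub(1)] edge_set_subsetI[OF g sub(2)] same by (intro subset_antisym) metis+
qed

text \<open>
  Let \<open>Z\<close> violate the conclusion. Then an edge of \<open>F\<close> crosses \<open>Z\<close>, so \<open>Z\<close> splits \<open>Y - X\<close>, and so do
  \<open>Z \<inter> Y\<close> and \<open>Y - Z\<close>, which satisfy the bound. Uncrossing with the tight set \<open>Y\<close> shows that \<open>Z \<union> Y\<close>
  and \<open>Z - Y\<close> have small cuts. These cuts contain no edge of \<open>F\<close>, so \<open>Z \<union> Y\<close> covers \<open>D - X\<close> and \<open>Z - Y\<close>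
  avoids it; then \<open>Y\<close> covers \<open>D - X\<close>, although it splits it.
\<close>

lemma cut_lift:
  assumes g: "edge_set E" and base: "\<And>Z. Z \<subseteq> D \<Longrightarrow> splits Z (D - X) \<Longrightarrow> K \<le> card (cut_edges E Z)"
    and Y: "Y \<subseteq> D" "splits Y (D - X)" "card (cut_edges E Y) = K"
    and F: "\<And>u v. {u,v} \<in> F \<Longrightarrow> u \<in> Y - X \<and> v \<in> Y - X"
    and inner: "\<And>Z. Z \<subseteq> Y \<Longrightarrow> splits Z (Y - X) \<Longrightarrow> K \<le> card (cut_edges (E - F) Z)"
    and Z: "Z \<subseteq> D" "splits Z (D - X)"
  shows "K \<le> card (cut_edges (E - F) Z)"
proof (rule ccontr)
  assume less: "\<not> K \<le> card (cut_edges (E - F) Z)"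
  have g': "edge_set (E - F)" using g edge_set_mono by blast
  have keep: "cut_edges (E - F) Z' = cut_edges E Z'" if "\<not> splits Z' (Y - X)" for Z'
    using cut_removed[OF g F] that by blast
  have sZ: "splits Z (Y - X)" using less keep base[OF Z] by force
  have Yc: "card (cut_edges (E - F) Y) = K" using keep[of Y] Y(3) by (auto simp: splits_def)
  have a: "K \<le> card (cut_edges (E - F) (Z \<inter> Y))" "K \<le> card (cut_edges (E - F) (Y - Z))"
    by (rule inner; use sZ in \<open>auto simp: splits_def\<close>)+
  have "card (cut_edges (E - F) (Z \<union> Y)) < K"
    using cut_submodular[OF g', of Z Y] a(1) Yc less by linarith
  moreover have "cut_edges (E - F) (Z \<union> Y) = cut_edges E (Z \<union> Y)" by (rule keep) (auto simp: splits_def)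
  ultimately have "\<not> splits (Z \<union> Y) (D - X)" using base[of "Z \<union> Y"] Z Y by auto
  then have cover: "D - X \<subseteq> Z \<union> Y" using Z by (auto simp: splits_def)
  have "card (cut_edges (E - F) (Z - Y)) < K"
    using cut_posimodular[OF g', of Z Y] a(2) Yc less by linarith
  moreover have "cut_edges (E - F) (Z - Y) = cut_edges E (Z - Y)" by (rule keep) (auto simp: splits_def)
  ultimately have "\<not> splits (Z - Y) (D - X)" using base[of "Z - Y"] Z by auto
  then have "(Z - Y) \<inter> (D - X) = {}" using Y(2) by (auto simp: splits_def)
  then show False using cover Y(2) by (auto simp: splits_def)
qed

text \<open>
  The condition \<open>F\<close> is the degree hypothesis in a form that survives both moves of the
  induction: passing to a set \<open>Y\<close> with exactly \<open>K\<close> leaving edges turns it into a lower bound for the degree inside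
  \<open>Y - X\<close>, and trading a leaf for an increase of \<open>K\<close> leaves the constant \<open>c = K + |VT| - 1\<close>
  unchanged.
\<close>

theorem tree_keeping_inner_cuts:
  assumes "itree VT ET" and g: "edge_set E" and r: "r \<in> V"
    and F: "\<And>Y v. Y \<subseteq> V - {r} \<Longrightarrow> v \<in> Y - X \<Longrightarrow> c \<le> card (cut_edges E Y) + card (nbrs E v \<inter> (Y - X))"
  shows "\<And>K D. Suc c = K + card VT \<Longrightarrow> D \<subseteq> V - {r} \<Longrightarrow> D - X \<noteq> {} \<Longrightarrow>
      (\<And>Z. Z \<subseteq> D \<Longrightarrow> splits Z (D - X) \<Longrightarrow> K \<le> card (cut_edges E Z)) \<Longrightarrow>
      (\<And>v. v \<in> D - X \<Longrightarrow> card VT - 1 \<le> card (nbrs E v \<inter> (D - X))) \<Longrightarrow>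
    \<exists>f. embeds f VT ET (D - X) E \<and>
      (\<forall>Z \<subseteq> D. splits Z (D - X) \<longrightarrow> K \<le> card (cut_edges (E - image_edges f ET) Z))"
  using assms(1)
proof (induction rule: itree.induct)
  case (single v)
  then obtain x where "x \<in> D - X" by blast
  then show ?case using single by (intro exI[of _ "\<lambda>_. x"]) (auto simp: embeds_def image_edges_def)
next
  case (leaf VT ET u l)
  let ?VT = "insert l VT" and ?ET = "insert {u, l} ET"
  note T = leaf.hyps
  have p: "finite VT" "ET \<subseteq> nsets VT 2" "card VT \<ge> 1" using itree_props[OF leaf.hyps(1)] by auto
  have p': "?ET \<subseteq> nsets ?VT 2" using itree_props[OF itree.leaf[OF leaf.hyps]] by auto
  have cV: "card ?VT = Suc (card VT)" using p leaf.hyps by simp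
  show ?case using leaf.prems
  proof (induction "card D" arbitrary: D rule: less_induct)
    case less
    have finD: "finite D" using less.prems(2) fin_V finite_subset by (metis finite_Diff)
    show ?case
    proof (cases "\<exists>Y \<subseteq> D. splits Y (D - X) \<and> card (cut_edges E Y) = K")
      case True
      then obtain Y where Y: "Y \<subseteq> D" "splits Y (D - X)" "card (cut_edges E Y) = K" by blast
      then have "Y \<subset> D" by (auto simp: splits_def)
      then have cY: "card Y < card D" using finD psubset_card_mono by blast
      have 1: "Y \<subseteq> V - {r}" "Y - X \<noteq> {}" using Y less.prems(2) by (auto simp: splits_def)
      have 2: "K \<le> card (cut_edges E Z)" if "Z \<subseteq> Y" "splits Z (Y - X)" for Z
        by (rule less.prems(4)) (use that Y(1) in \<open>auto simp: splits_def\<close>)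
      have 3: "card ?VT - 1 \<le> card (nbrs E v \<inter> (Y - X))" if "v \<in> Y - X" for v
        using F[OF 1(1) that] Y(3) less.prems(1) cV by simp
      obtain f where f: "embeds f ?VT ?ET (Y - X) E"
        "\<And>Z. Z \<subseteq> Y \<Longrightarrow> splits Z (Y - X) \<Longrightarrow> K \<le> card (cut_edges (E - image_edges f ?ET) Z)"
        using less.hyps[OF cY less.prems(1) 1 2 3] by blast
      have "a \<in> Y - X \<and> b \<in> Y - X" if "{a,b} \<in> image_edges f ?ET" for a b
        using image_edges_inside[OF p' f(1) that] f(1) by (auto simp: embeds_def)
      note cut_lift[OF g less.prems(4) Y this f(2)]
      moreover have "embeds f ?VT ?ET (D - X) E" using embeds_mono[OF f(1)] Y(1) by blast
      ultimately show ?thesis by blast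
    next
      case False
      have 1: "Suc K \<le> card (cut_edges E Z)" if "Z \<subseteq> D" "splits Z (D - X)" for Z
        using less.prems(4)[OF that] False that by (metis le_neq_implies_less Suc_leI)
      have 2: "card VT - 1 \<le> card (nbrs E v \<inter> (D - X))" if "v \<in> D - X" for v
        using less.prems(5)[OF that] cV by simp
      have "Suc c = Suc K + card VT" using less.prems(1) cV by simp
      from leaf.IH[OF this less.prems(2,3) 1 2]
      obtain f where f: "embeds f VT ET (D - X) E"
        "\<And>Z. Z \<subseteq> D \<Longrightarrow> splits Z (D - X) \<Longrightarrow> Suc K \<le> card (cut_edges (E - image_edges f ET) Z)"
        by blast
      let ?E0 = "E - image_edges f ET"
      have x: "f u \<in> D - X" using f(1) T(2) by (auto simp: embeds_def)
      have "\<not> nbrs E (f u) \<inter> (D - X) \<subseteq> f ` (VT - {u})"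
      proof
        assume "nbrs E (f u) \<inter> (D - X) \<subseteq> f ` (VT - {u})"
        then have "card (nbrs E (f u) \<inter> (D - X)) \<le> card (f ` (VT - {u}))" using p by (intro card_mono) auto
        also have "\<dots> \<le> card (VT - {u})" using p by (intro card_image_le) auto
        also have "\<dots> = card VT - 1" using T(2) by simp
        finally show False using less.prems(5)[OF x] cV p(3) by simp
      qed
      then obtain y where y0: "y \<in> nbrs E (f u)" "y \<in> D - X" "y \<notin> f ` (VT - {u})" by blast
      then have y: "y \<in> D - X" "{f u, y} \<in> E" "y \<notin> f ` VT"
        using nbrs_subset[OF g, of "f u"] by (auto simp: nbrs_def)
      have "embeds (f(l := y)) ?VT ?ET (D - X) E"
        by (rule embeds_extend[OF p(2) T(2,3) f(1) y(1,3,2)])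
      moreover have "K \<le> card (cut_edges (?E0 - {{f u, y}}) Z)" if "Z \<subseteq> D" "splits Z (D - X)" for Z
      proof -
        have g': "edge_set (?E0 - {{f u, y}})" by (rule edge_set_mono[OF g]) auto
        have "Suc K \<le> card (cut_edges ?E0 Z)" using f(2)[OF that] .
        also have "\<dots> \<le> card (insert {f u, y} (cut_edges (?E0 - {{f u, y}}) Z))"
        proof (rule card_mono)
          show "cut_edges ?E0 Z \<subseteq> insert {f u, y} (cut_edges (?E0 - {{f u, y}}) Z)" unfolding cut_edges_def by blast
        qed (simp add: fin_cut[OF g'])
        also have "\<dots> \<le> Suc (card (cut_edges (?E0 - {{f u, y}}) Z))"
          using fin_cut[OF g'] by (simp add: card_insert_if)
        finally show ?thesis by simp
      qed
      ultimately show ?thesis unfolding minus_image_edges_extend[OF p(2) T(2,3), symmetric] by blast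
    qed
  qed
qed

text \<open>
  If \<open>Q\<close> is not empty the root \<open>r\<close> lies in \<open>Q\<close>. For \<open>Y\<close> avoiding \<open>r\<close> every vertex of \<open>Q \<inter> Y\<close> then sends
  an edge to \<open>r\<close>; these edges leave \<open>Y\<close> and do not contain \<open>v\<close>, so they compensate for the neighbours
  of \<open>v\<close> in \<open>Q \<inter> Y\<close> that are lost because they lie in \<open>X\<close>. If \<open>Q\<close> is empty the full degree bound is
  available and the root may be any vertex outside \<open>X\<close>. Complements have the same
  cut, so it suffices to treat sets avoiding \<open>r\<close>.
\<close>

theorem tree_keeping_cuts:
  assumes T: "itree VT ET" and g: "edge_set E" and k: "q \<le> k" "1 \<le> k"
    and Q: "Q \<subseteq> X" "card Q = q" "\<And>a b. a \<in> Q \<Longrightarrow> b \<in> Q \<Longrightarrow> a \<noteq> b \<Longrightarrow> {a,b} \<in> E"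
    and deg: "\<And>v. v \<in> V - X \<Longrightarrow> k + card VT - 1 + card X \<le> card (nbrs E v) + q"
    and W: "V - X \<noteq> {}"
    and cuts: "\<And>Z. Z \<noteq> {} \<Longrightarrow> Z \<subset> V \<Longrightarrow> k \<le> card (cut_edges E Z)"
  shows "\<exists>f. embeds f VT ET (V - X) E \<and> (\<forall>Z. Z \<noteq> {} \<longrightarrow> Z \<subset> V \<longrightarrow> k \<le> card (cut_edges (E - image_edges f ET) Z))"
proof -
  have p: "finite VT" "ET \<subseteq> nsets VT 2" "card VT \<ge> 1" using itree_props[OF T] by auto
  have finX: "finite X" using X_sub fin_V finite_subset by blast
  have finQ: "finite Q" using Q finX finite_subset by blast
  obtain r where r: "r \<in> V" "Q \<noteq> {} \<Longrightarrow> r \<in> Q" "Q = {} \<Longrightarrow> r \<notin> X"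
    using W Q(1) X_sub by blast
  have XQ: "card (X - Q) = card X - q" "q \<le> card X" using Q finX finQ by (auto simp: card_Diff_subset card_mono)
  have F: "k + card VT - 1 \<le> card (cut_edges E Y) + card (nbrs E v \<inter> (Y - X))"
    if Y: "Y \<subseteq> V - {r}" and v: "v \<in> Y - X" for Y v
  proof -
    \<comment> \<open>\<open>A\<close> are the edges at \<open>v\<close> that leave \<open>Y\<close>, \<open>B\<close> the clique edges from \<open>Y\<close> to the root.\<close>
    define A where "A = (\<lambda>b. {v, b}) ` (nbrs E v - Y)"
    define B where "B = (\<lambda>a. {a, r}) ` (Q \<inter> Y)"
    have "card A = card (nbrs E v - Y)" unfolding A_def
      by (rule card_image) (auto simp: inj_on_def doubleton_eq_iff)
    moreover have "card B = card (Q \<inter> Y)" unfolding B_def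
      by (rule card_image) (auto simp: inj_on_def doubleton_eq_iff)
    moreover have "A \<inter> B = {}"
    proof -
      have "v \<noteq> r" "v \<notin> Q" using v Y Q(1) by auto
      then show ?thesis by (auto simp: A_def B_def doubleton_eq_iff)
    qed
    moreover have "A \<union> B \<subseteq> cut_edges E Y"
    proof -
      have "{a, r} \<in> E" if "a \<in> Q \<inter> Y" for a
        using Q(3)[of a r] r(2) that Y by auto
      then show ?thesis using v Y by (auto simp: A_def B_def in_cut nbrs_def)
    qed
    moreover have "finite A" "finite B" using fin_nbrs[OF g] finQ by (auto simp: A_def B_def)
    ultimately have 1: "card (nbrs E v - Y) + card (Q \<inter> Y) \<le> card (cut_edges E Y)"
      using card_mono[OF fin_cut[OF g]] by (metis card_Un_disjoint)
    have "nbrs E v \<subseteq> (nbrs E v - Y) \<union> (nbrs E v \<inter> (Y - X)) \<union> (Q \<inter> Y) \<union> (X - Q)" by auto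
    then have "card (nbrs E v) \<le> card ((nbrs E v - Y) \<union> (nbrs E v \<inter> (Y - X)) \<union> (Q \<inter> Y) \<union> (X - Q))"
      using fin_nbrs[OF g] finQ finX by (intro card_mono) auto
    also have "\<dots> \<le> card (nbrs E v - Y) + card (nbrs E v \<inter> (Y - X)) + card (Q \<inter> Y) + card (X - Q)"
      by (intro order_trans[OF card_Un_le] add_right_mono order_refl)
    finally have 2: "card (nbrs E v) \<le> \<dots>" .
    show ?thesis using 1 2 XQ deg[of v] v Y by auto
  qed
  define D where "D = V - {r}"
  have rV: "card (insert r X) \<le> card X + (if Q = {} then 1 else 0)"
  proof (cases "Q = {}")
    case False
    then have "insert r X = X" using r(2) Q(1) by auto
    then show ?thesis by simp
  qed (simp add: card_insert_if finX)
  have low: "card VT - 1 \<le> card (nbrs E v \<inter> (D - X))" if v: "v \<in> V - X" for v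
  proof -
    have "nbrs E v \<subseteq> (nbrs E v \<inter> (D - X)) \<union> insert r X" using nbrs_subset[OF g, of v] by (auto simp: D_def)
    then have "card (nbrs E v) \<le> card ((nbrs E v \<inter> (D - X)) \<union> insert r X)"
      using fin_nbrs[OF g] finX by (intro card_mono) auto
    also have "\<dots> \<le> card (nbrs E v \<inter> (D - X)) + card (insert r X)" by (rule card_Un_le)
    finally show ?thesis using rV deg[OF v] k Q(2) by (auto split: if_splits)
  qed
  have DX: "D - X \<noteq> {}"
  proof (cases "Q = {}")
    case True
    have rW: "r \<in> V - X" using r True by auto
    have "nbrs E r \<noteq> {} \<and> \<not> nbrs E r \<subseteq> X"
    proof -
      have "card X < card (nbrs E r)" using deg[OF rW] True Q(2) k p(3) by auto
      then show ?thesis using card_mono[OF finX, of "nbrs E r"] by auto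
    qed
    then show ?thesis using nbrs_subset[OF g, of r] by (auto simp: D_def)
  next
    case False
    then show ?thesis using r(2) Q(1) W by (auto simp: D_def)
  qed
  have "\<exists>f. embeds f VT ET (D - X) E \<and>
      (\<forall>Z \<subseteq> D. splits Z (D - X) \<longrightarrow> k \<le> card (cut_edges (E - image_edges f ET) Z))"
  proof (rule tree_keeping_inner_cuts[OF T g r(1) F])
    show "Suc (k + card VT - 1) = k + card VT" using k by simp
    show "k \<le> card (cut_edges E Z)" if "Z \<subseteq> D" "splits Z (D - X)" for Z
      by (rule cuts) (use that r(1) in \<open>auto simp: D_def splits_def\<close>)
  qed (use low DX in \<open>auto simp: D_def\<close>)
  then obtain f where f: "embeds f VT ET (D - X) E"
    "\<And>Z. Z \<subseteq> D \<Longrightarrow> splits Z (D - X) \<Longrightarrow> k \<le> card (cut_edges (E - image_edges f ET) Z)" by blast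
  let ?E = "E - image_edges f ET"
  have g': "edge_set ?E" using edge_set_mono[OF g] by blast
  have inD: "a \<in> D - X \<and> b \<in> D - X" if "{a,b} \<in> image_edges f ET" for a b
    using image_edges_inside[OF p(2) f(1) that] f(1) by (auto simp: embeds_def)
  have avoid_r: "k \<le> card (cut_edges ?E Z)" if Z: "Z \<noteq> {}" "Z \<subset> V" "r \<notin> Z" for Z
  proof -
    have "cut_edges ?E Z = cut_edges E Z \<or> splits Z (D - X)" by (rule cut_removed[OF g inD])
    moreover have "Z \<subseteq> D" using Z by (auto simp: D_def)
    ultimately show ?thesis using f(2)[of Z] cuts[OF Z(1,2)] by auto
  qed
  have "k \<le> card (cut_edges ?E Z)" if Z: "Z \<noteq> {}" "Z \<subset> V" for Z
  proof (cases "r \<in> Z")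
    case True
    have "k \<le> card (cut_edges ?E (V - Z))" by (rule avoid_r) (use Z True in auto)
    then show ?thesis by (simp add: cut_compl[OF g'])
  qed (use avoid_r Z in auto)
  moreover have "embeds f VT ET (V - X) E" using embeds_mono[OF f(1)] by (auto simp: D_def)
  ultimately show ?thesis by blast
qed

end

section \<open>Connectivity of graphs\<close>

lemma degree_eq_card_nbrs:
  assumes "simple_graph G"
  shows "degree G v = card (nbrs (edges G) v)"
proof -
  have "{e \<in> edges G. v \<in> e} = (\<lambda>u. {v, u}) ` nbrs (edges G) v"
  proof
    show "{e \<in> edges G. v \<in> e} \<subseteq> (\<lambda>u. {v, u}) ` nbrs (edges G) v"
      using assms by (fastforce simp: simple_graph_def nsets_def card_2_iff nbrs_def insert_commute)
  qed (auto simp: nbrs_def)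
  moreover have "inj_on (\<lambda>u. {v, u}) (nbrs (edges G) v)" by (auto simp: inj_on_def doubleton_eq_iff)
  ultimately show ?thesis by (simp add: degree_def card_image)
qed

lemma k_connected_iff_sep_bound:
  assumes G: "simple_graph G" and X: "X \<subseteq> verts G"
  shows "k_connected k G \<longleftrightarrow> card (verts G) \<ge> k + 1 \<and> vertex_sets.sep_bound (verts G) X 0 k (edges G)"
proof -
  interpret vertex_sets "verts G" X using G X by unfold_locales (auto simp: simple_graph_def)
  have g: "edges G \<subseteq> nsets (verts G) 2" using G by (simp add: simple_graph_def)
  have V: "verts (del_verts G S) = verts G - S" for S by (simp add: del_verts_def induced_def)
  have E: "{a, b} \<in> edges (del_verts G S) \<longleftrightarrow> {a, b} \<in> edges G \<and> a \<in> verts G - S \<and> b \<in> verts G - S" for S a b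
    by (auto simp: del_verts_def induced_def)
  have crossing: "connected_graph (del_verts G S) \<longleftrightarrow> verts G - S \<noteq> {} \<and> (\<forall>A. A \<subseteq> verts G - S \<and> A \<noteq> {} \<and> A \<noteq> verts G - S \<longrightarrow>
      (\<exists>a\<in>A. \<exists>b\<in>verts G - S - A. {a, b} \<in> edges G))" for S
  proof -
    have sub: "edges (del_verts G S) \<subseteq> nsets (verts (del_verts G S)) 2"
      using g by (auto simp: del_verts_def induced_def nsets_def)
    have "(\<exists>a\<in>A. \<exists>b\<in>verts G - S - A. {a, b} \<in> edges (del_verts G S)) \<longleftrightarrow>
        (\<exists>a\<in>A. \<exists>b\<in>verts G - S - A. {a, b} \<in> edges G)" if "A \<subseteq> verts G - S" for A
      using that unfolding E by blast
    then show ?thesis unfolding connected_graph_iff_crossing[OF sub] V by (metis (no_types, lifting))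
  qed
  show ?thesis
  proof (intro iffI conjI)
    assume L: "k_connected k G"
    then show "card (verts G) \<ge> k + 1" by (simp add: k_connected_def)
    show "sep_bound 0 k (edges G)"
      unfolding sep_bound_def
    proof (intro allI impI, elim conjE, rule ccontr)
      fix A B assume AB: "sep (edges G) A B" "A \<noteq> {}" "B \<noteq> {}" "\<not> k \<le> sep_cost 0 A B"
      let ?S = "verts G - (A \<union> B)"
      have d: "A \<subseteq> verts G" "B \<subseteq> verts G" "A \<inter> B = {}" and no: "\<And>a b. a \<in> A \<Longrightarrow> b \<in> B \<Longrightarrow> {a, b} \<notin> edges G"
        using AB(1) by (auto simp: sep_def)
      have "card ?S < k" using AB(4) by (simp add: sep_cost_def)
      then have c: "connected_graph (del_verts G ?S)" using L by (simp add: k_connected_def)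
      have S: "verts G - ?S = A \<union> B" using d by auto
      have "A \<noteq> A \<union> B" using d AB(3) by auto
      then obtain a b where "a \<in> A" "b \<in> A \<union> B - A" "{a, b} \<in> edges G"
        using c AB(2) unfolding crossing S by blast
      then show False using no by blast
    qed
  next
    assume R: "card (verts G) \<ge> k + 1 \<and> sep_bound 0 k (edges G)"
    show "k_connected k G"
      unfolding k_connected_def
    proof (intro conjI allI impI)
      fix S assume S: "S \<subseteq> verts G \<and> card S < k"
      show "connected_graph (del_verts G S)"
        unfolding crossing
      proof (intro conjI allI impI, goal_cases)
        case 1
        have "S \<noteq> verts G" using R S by auto
        then show ?case using S by blast
      next
        case (2 A)
        show ?case
        proof (rule ccontr)
          assume no: "\<not> ?thesis"
          let ?B = "verts G - S - A"
          have "sep (edges G) A ?B" using 2 no by (auto simp: sep_def)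
          then have "k \<le> sep_cost 0 A ?B" using R 2 by (intro sep_boundD) auto
          moreover have "verts G - (A \<union> ?B) = S" using 2 S by auto
          ultimately show False using S by (simp add: sep_cost_def)
        qed
      qed
    qed (use R in auto)
  qed
qed

lemma k_edge_connected_iff_cuts:
  assumes G: "simple_graph G" and k: "k \<ge> 1"
  shows "k_edge_connected k G \<longleftrightarrow> verts G \<noteq> {} \<and>
    (\<forall>Z. Z \<noteq> {} \<longrightarrow> Z \<subset> verts G \<longrightarrow> k \<le> card (vertex_sets.cut_edges (edges G) Z))"
proof -
  interpret vertex_sets "verts G" "{}" using G by unfold_locales (auto simp: simple_graph_def)
  have g: "edges G \<subseteq> nsets (verts G) 2" using G by (simp add: simple_graph_def)
  then have edge_set: "edge_set (edges G)" by (simp add: edge_set_def)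
  have V: "verts (del_edges G F) = verts G" and E: "edges (del_edges G F) = edges G - F" for F
    by (simp_all add: del_edges_def)
  have crossing: "connected_graph (del_edges G F) \<longleftrightarrow> verts G \<noteq> {} \<and> (\<forall>A. A \<subseteq> verts G \<and> A \<noteq> {} \<and> A \<noteq> verts G \<longrightarrow>
      (\<exists>a\<in>A. \<exists>b\<in>verts G - A. {a, b} \<in> edges G - F))" for F
  proof -
    have sub: "edges (del_edges G F) \<subseteq> nsets (verts (del_edges G F)) 2"
      using g unfolding V E by blast
    show ?thesis unfolding connected_graph_iff_crossing[OF sub] V E ..
  qed
  show ?thesis
  proof (intro iffI conjI allI impI)
    assume L: "k_edge_connected k G"
    then have "connected_graph (del_edges G {})" using k by (simp add: k_edge_connected_def)
    then show "verts G \<noteq> {}" using crossing by blast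
    fix Z assume Z: "Z \<noteq> {}" "Z \<subset> verts G"
    show "k \<le> card (cut_edges (edges G) Z)"
    proof (rule ccontr)
      assume "\<not> ?thesis"
      then have "connected_graph (del_edges G (cut_edges (edges G) Z))"
        using L by (simp add: k_edge_connected_def cut_edges_def)
      then obtain a b where "a \<in> Z" "b \<in> verts G - Z" "{a, b} \<in> edges G - cut_edges (edges G) Z"
        using Z unfolding crossing by blast
      then show False by (auto simp: in_cut)
    qed
  next
    assume R: "verts G \<noteq> {} \<and> (\<forall>Z. Z \<noteq> {} \<longrightarrow> Z \<subset> verts G \<longrightarrow> k \<le> card (cut_edges (edges G) Z))"
    show "k_edge_connected k G"
      unfolding k_edge_connected_def crossing
    proof (intro conjI allI impI, goal_cases)
      case 1 then show ?case using R by blast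
    next
      case (2 F A)
      show ?case
      proof (rule ccontr)
        assume no: "\<not> ?thesis"
        have "{u, v} \<in> F" if uv: "{u, v} \<in> cut_edges (edges G) A" for u v
        proof -
          have e: "{u, v} \<in> edges G" "u \<in> verts G" "v \<in> verts G" "u \<in> A \<longleftrightarrow> v \<notin> A"
            using uv edge_in_verts[OF g] by (auto simp: in_cut)
          moreover have "{v, u} = {u, v}" by auto
          ultimately show ?thesis using no by (cases "u \<in> A") (metis Diff_iff)+
        qed
        moreover have "cut_edges (edges G) A \<subseteq> edges G" by (auto simp: cut_edges_def)
        ultimately have "cut_edges (edges G) A \<subseteq> F" using edge_set_subsetI[OF edge_set] by blast
        moreover have "finite F" using 2 finite_edge_set[OF edge_set] finite_subset by blast
        ultimately have "card (cut_edges (edges G) A) < k" using 2 card_mono le_less_trans by blast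
        then show False using R 2 by (metis not_le psubset_eq)
      qed
    qed
  qed
qed

lemma embeds_subtree:
  assumes T: "tree T" and f: "embeds f (verts T) (edges T) (verts G - X) (edges G)"
  defines "T' \<equiv> \<lparr>verts = f ` verts T, edges = image_edges f (edges T)\<rparr>"
  shows "subtree T' (del_verts G X)" and "isomorphic T' T"
proof -
  have inj: "inj_on f (verts T)" using f by (simp add: embeds_def)
  note t = image_tree[OF T inj, folded T'_def]
  show "isomorphic T' T" by (rule t(2))
  have sg: "simple_graph T'" using t(1) by (simp add: tree_def)
  have "e \<subseteq> f ` verts T" if "e \<in> image_edges f (edges T)" for e
    using that sg by (auto simp: simple_graph_def T'_def nsets_def)
  then show "subtree T' (del_verts G X)"
    using t(1) sg f by (fastforce simp: subtree_def subgraph_def T'_def embeds_def del_verts_def induced_def)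
qed

theorem theorem1p3:
  fixes k m q :: nat
    and G :: "'a ugraph"
    and T :: "'b ugraph"
    and X :: "'a set"
  assumes "k \<ge> 1" and "m \<ge> 1"
    and "simple_graph G"
    and "tree T" and "card (verts T) = m"
    and "X \<subset> verts G"
    and "k \<ge> q"
    and "has_clique (induced G X) q"
    and "\<forall>v \<in> verts G - X. degree G v \<ge> k + m - 1 + card X - q"
  shows "(k_connected k G \<longrightarrow>
            (\<exists>T'. subtree T' (del_verts G X) \<and> isomorphic T' T \<and>
                  k_connected k (del_edges G (edges T')))) \<and>
         (k_edge_connected k G \<longrightarrow>
            (\<exists>T'. subtree T' (del_verts G X) \<and> isomorphic T' T \<and>
                  k_edge_connected k (del_edges G (edges T'))))"
proof -
  interpret vertex_sets "verts G" X
    using assms(3,6) by unfold_locales (auto simp: simple_graph_def)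
  have g: "edge_set (edges G)" using assms(3) by (simp add: simple_graph_def edge_set_def)
  have T: "itree (verts T) (edges T)" by (rule tree_imp_itree[OF assms(4)])
  have XV: "X \<subseteq> verts G" "verts G - X \<noteq> {}" using assms(6) by auto
  obtain Q where Q: "Q \<subseteq> X" "card Q = q" "clique Q {e \<in> edges G. e \<subseteq> X}"
    using assms(8) by (auto simp: has_clique_def induced_def)
  have qX: "q \<le> card X" using Q(1,2) XV(1) fin_V by (metis card_mono finite_subset)
  have deg: "k + card (verts T) - 1 + card X \<le> card (nbrs (edges G) v) + q" if "v \<in> verts G - X" for v
  proof -
    have "k + m - 1 + card X - q \<le> degree G v" using assms(9) that by blast
    then show ?thesis using assms(5) degree_eq_card_nbrs[OF assms(3), of v] by linarith
  qed
  have m: "card (verts T) \<ge> 1" using assms(2,5) by simp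
  have simple: "simple_graph (del_edges G F)" for F
    using assms(3) by (auto simp: simple_graph_def del_edges_def)
  show ?thesis
  proof (intro conjI impI)
    assume "k_connected k G"
    then have c: "card (verts G) \<ge> k + 1" "sep_bound 0 k (edges G)"
      using k_connected_iff_sep_bound[OF assms(3) XV(1)] by auto
    have "\<exists>f. embeds f (verts T) (edges T) (verts G - X) (edges G) \<and>
        sep_bound 0 (k + 0) (edges G - image_edges f (edges T))"
    proof (rule tree_keeping_sep_bound[OF T g])
      fix v assume v: "v \<in> verts G - X"
      show "k + 0 + card (verts T) - 1 \<le> card (nbrs (edges G) v)" using deg[OF v] qX by simp
      show "card (verts T) - 1 + card X \<le> card (nbrs (edges G) v)" using deg[OF v] assms(7) m by simp
    qed (use c XV in auto)
    then obtain f where f: "embeds f (verts T) (edges T) (verts G - X) (edges G)"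
      "sep_bound 0 k (edges G - image_edges f (edges T))" by auto
    let ?T' = "\<lparr>verts = f ` verts T, edges = image_edges f (edges T)\<rparr>"
    have "k_connected k (del_edges G (edges ?T'))"
      using k_connected_iff_sep_bound[OF simple, of X] XV(1) c(1) f(2) by (simp add: del_edges_def)
    then show "\<exists>T'. subtree T' (del_verts G X) \<and> isomorphic T' T \<and> k_connected k (del_edges G (edges T'))"
      using embeds_subtree[OF assms(4) f(1)] by blast
  next
    assume "k_edge_connected k G"
    then have cuts: "verts G \<noteq> {}" "\<And>Z. Z \<noteq> {} \<Longrightarrow> Z \<subset> verts G \<Longrightarrow> k \<le> card (cut_edges (edges G) Z)"
      using k_edge_connected_iff_cuts[OF assms(3,1)] by auto
    have cl: "{a, b} \<in> edges G" if "a \<in> Q" "b \<in> Q" "a \<noteq> b" for a b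
      using Q(3) that by (auto simp: clique_def)
    obtain f where f: "embeds f (verts T) (edges T) (verts G - X) (edges G)"
      "\<And>Z. Z \<noteq> {} \<Longrightarrow> Z \<subset> verts G \<Longrightarrow> k \<le> card (cut_edges (edges G - image_edges f (edges T)) Z)"
      using tree_keeping_cuts[OF T g assms(7,1) Q(1,2) cl deg XV(2) cuts(2)] by blast
    let ?T' = "\<lparr>verts = f ` verts T, edges = image_edges f (edges T)\<rparr>"
    have "k_edge_connected k (del_edges G (edges ?T'))"
      using k_edge_connected_iff_cuts[OF simple assms(1)] cuts(1) f(2) by (simp add: del_edges_def)
    then show "\<exists>T'. subtree T' (del_verts G X) \<and> isomorphic T' T \<and> k_edge_connected k (del_edges G (edges T'))"
      using embeds_subtree[OF assms(4) f(1)] by blast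
  qed
qed

end
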